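(* Let $\alpha,\beta>-1$, let $g\in H(\mathbb{D})$, and let $0<p,q<\infty$. Then the following statements hold. (1) If $p<\alpha+2$, then $T_g:D_\alpha^p\to D_\beta^q$ is order bounded if and only if $$\int_{\mathbb{D}}\frac{|g'(z)|^q}{(1-|z|^2)^{q(\alpha+2-p)/p}}\,dA_\beta(z)<\infty.$$ (2) If $p=\alpha+2$, then $T_g:D_\alpha^p\to D_\beta^q$ is order bounded if and only if $$\int_{\mathbb{D}}\frac{|g'(z)|^q}{\left(\log\frac{2}{1-|z|^2}\right)^{q(1-p)/p}}\,dA_\beta(z)<\infty.$$ (3) If $p>\alpha+2$, then $T_g:D_\alpha^p\to D_\beta^q$ is order bounded if and only if $g\in D_\beta^q$.
   Context: $\mathbb{D}$ is the open unit disk in $\mathbb{C}$, $H(\mathbb{D})$ is the space of analytic functions on $\mathbb{D}$, $dA(z)=\frac1\pi\,dx\,dy$ is normalized area measure, and $dA_\beta(z)=(1-|z|^2)^\beta\,dA(z)$. For $0<p<\infty$ and $\alpha>-1$, the weighted Dirichlet space $D_\alpha^p$ is the set of $f\in H(\mathbb{D})$ with $\|f\|_{D_\alpha^p}=\left(|f(0)|^p+\int_{\mathbb{D}}|f'(z)|^p(1-|z|^2)^\alpha\,dA(z)\right)^{1/p}<\infty$. For $g\in H(\mathbb{D})$, the Volterra type operator is $(T_gf)(z)=\int_0^z f(\omega)g'(\omega)\,d\omega$, $f\in H(\mathbb{D})$. An operator $T:D_\alpha^p\to D_\beta^q$ is called order bounded if there exists a nonnegative function $h\in L^q(A_\beta)$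 such that for every $f\in D_\alpha^p$ with $\|f\|_{D_\alpha^p}\le1$ one has $|(Tf)'(z)|\le h(z)$ for $A_\beta$-almost every $z\in\mathbb{D}$. *)

theory Defs
  imports "HOL-Complex_Analysis.Complex_Analysis"
begin

abbreviation unit_disc :: "complex set" where
  "unit_disc \<equiv> ball 0 1"

definition disc_area :: "complex measure" where
  "disc_area = scale_measure (ennreal (1 / pi)) (restrict_space lborel unit_disc)"

definition weighted_area :: "real \<Rightarrow> complex measure" where
  "weighted_area \<beta> = density disc_area (\<lambda>z. ennreal ((1 - (cmod z)\<^sup>2) powr \<beta>))"

definition Lebesgue_space :: "real \<Rightarrow> 'a measure \<Rightarrow> ('a \<Rightarrow> real) set" where
  "Lebesgue_space q M =
     {h \<in> borel_measurable M. (\<integral>\<^sup>+ z. ennreal (\<bar>h z\<bar> powr q) \<partial>M) < \<infinity>}"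

definition dirichlet_integral :: "real \<Rightarrow> real \<Rightarrow> (complex \<Rightarrow> complex) \<Rightarrow> ennreal" where
  "dirichlet_integral \<alpha> p f =
     (\<integral>\<^sup>+ z. ennreal (cmod (deriv f z) powr p) \<partial>weighted_area \<alpha>)"

text \<open>Elements are functions on all of \<open>\<complex>\<close>; only their values on the disc matter.\<close>

definition dirichlet_space :: "real \<Rightarrow> real \<Rightarrow> (complex \<Rightarrow> complex) set" where
  "dirichlet_space \<alpha> p = {f. f holomorphic_on unit_disc \<and> dirichlet_integral \<alpha> p f < \<infinity>}"

text \<open>Meaningful only for members of \<^const>\<open>dirichlet_space\<close>, since
  \<^const>\<open>enn2real\<close> sends \<open>\<infinity>\<close> to 0.\<close>

definition dirichlet_norm :: "real \<Rightarrow> real \<Rightarrow> (complex \<Rightarrow> complex) \<Rightarrow> real" where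
  "dirichlet_norm \<alpha> p f =
     (cmod (f 0) powr p + enn2real (dirichlet_integral \<alpha> p f)) powr (1 / p)"

definition volterra :: "(complex \<Rightarrow> complex) \<Rightarrow> (complex \<Rightarrow> complex) \<Rightarrow> complex \<Rightarrow> complex" where
  "volterra g f z = contour_integral (linepath 0 z) (\<lambda>w. f w * deriv g w)"

text \<open>Order boundedness of \<open>T\<close> as an operator from \<open>D\<^sub>\<alpha>\<^sup>p\<close> to \<open>D\<^sub>\<beta>\<^sup>q\<close>;
  the first conjunct says that \<open>T\<close> is such an operator.\<close>

definition order_bounded ::
    "real \<Rightarrow> real \<Rightarrow> real \<Rightarrow> real \<Rightarrow> ((complex \<Rightarrow> complex) \<Rightarrow> complex \<Rightarrow> complex) \<Rightarrow> bool" where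
  "order_bounded \<alpha> p \<beta> q T \<longleftrightarrow>
     T ` dirichlet_space \<alpha> p \<subseteq> dirichlet_space \<beta> q \<and>
     (\<exists>h \<in> Lebesgue_space q (weighted_area \<beta>).
        (\<forall>z\<in>unit_disc. 0 \<le> h z) \<and>
        (\<forall>f \<in> dirichlet_space \<alpha> p. dirichlet_norm \<alpha> p f \<le> 1 \<longrightarrow>
           (AE z in weighted_area \<beta>. cmod (deriv (T f) z) \<le> h z)))"

end

theory Submission imports Defs begin

text \<open>
  Since \<open>(T\<^sub>g f)' = f g'\<close>, order boundedness is governed by \<open>\<Phi>(z) = sup |f(z)|\<close> over the unit ball
  of \<open>D\<^sub>\<alpha>\<^sup>p\<close>: it holds iff \<open>g' \<Phi>\<close> is in \<open>L\<^sup>q(A\<^sub>\<beta>)\<close>. So \<open>\<Phi>\<close> has to be found up to constants.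

  Upper bounds integrate \<open>f'\<close> along a radius. For \<open>p \<noteq> \<alpha> + 2\<close> the pointwise bound
  \<open>|f'(z)| \<le> C (1 - |z|)\<^bsup>-(\<alpha>+2)/p\<^esup>\<close> from the submean value property of \<open>|f'|\<^sup>p\<close> suffices. For
  \<open>p = \<alpha> + 2\<close> it would lose a power of the logarithm; there the submean value property is integrated
  over the radius, and a Hoelder-type splitting gives \<open>\<Phi> \<le> C L\<^bsup>1-1/p\<^esup>\<close> with \<open>L = log (2 / (1 - |z|\<^sup>2))\<close>.

  Lower bounds come from the constant \<open>1\<close> (\<open>p > \<alpha> + 2\<close>), from
  \<open>L(a)\<^bsup>-1/p\<^esup> log (2 / (1 - cnj a z))\<close> (\<open>p = \<alpha> + 2\<close>) and from
  \<open>(1 - |a|\<^sup>2)\<^bsup>n+1-(\<alpha>+2)/p\<^esup> (1 - cnj a z)\<^bsup>-n\<^esup>\<close> with a large integer \<open>n\<close> (\<open>p < \<alpha> + 2\<close>), evaluated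
  at \<open>z = a\<close>. Their norms are controlled by averaging \<open>|1 - cnj a w|\<^bsup>-c\<^esup>\<close> over rotations of \<open>w\<close>,
  which replaces polar coordinates.
\<close>

section \<open>Rotation invariance of Lebesgue measure and angular averages\<close>

text \<open>At \<open>p = \<alpha> + 2\<close> the pointwise bound for \<open>f'\<close> charges the
  whole Dirichlet integral to every single point of a radius, and integrating it gives
  \<open>L\<close> instead of \<open>L^(1-1/p)\<close>. The discs of radius
  \<open>(1 - t) / 2\<close> around the points at distance \<open>t\<close> from the origin,
  however, contain a given \<open>w\<close> only while \<open>1 - t\<close> is comparable to
  \<open>1 - |w|^2\<close>. So one copy of the Dirichlet integral pays for the whole radius.

  The factors in front of the test functions are dictated by the kernel: the integral of
  \<open>(1 - |w|^2)^\<alpha> |1 - cnj a w|^(-c)\<close> over the disc is at most a constant times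
  \<open>(1 - |a|^2)^(\<alpha>+2-c)\<close> if \<open>c > \<alpha> + 2\<close>, and at most a
  constant times \<open>L(a)\<close> if \<open>c = \<alpha> + 2\<close>. The p-th power of the
  factor cancels exactly this. The exponent \<open>n\<close> is large enough to make
  \<open>c = (n + 1) p\<close> exceed \<open>\<alpha> + 2\<close>, and it is an integer so that no
  branch of a power is involved.

  For \<open>p < 1\<close> convexity gives no submean value property of \<open>|f'|^p\<close>; a
  maximum argument replaces it.\<close>

text \<open>Uniqueness of Haar measure, written without division. With \<open>B\<close> a fixed ball
  of known measure it identifies \<open>M\<close> up to a factor. Symmetry of \<open>B\<close> turns
  \<open>x - y\<close> into \<open>y - x\<close>, so that only translations of both measures are
  used.\<close>

lemma translation_invariant_measure_proportional:
  fixes M :: "'a::euclidean_space measure"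
  assumes M: "sigma_finite_measure M" "sets M = sets borel"
    and trans: "\<And>c. distr M borel ((+) c) = M"
    and A: "A \<in> sets borel" and B: "B \<in> sets borel" "\<And>x. x \<in> B \<Longrightarrow> -x \<in> B"
  shows "emeasure M A * emeasure lborel B = emeasure M B * emeasure lborel A"
proof -
  interpret M: sigma_finite_measure M by fact
  interpret P: pair_sigma_finite M "lborel :: 'a measure" ..
  note [measurable_cong] = M(2)
  note [measurable] = A B(1)
  have symB: "indicator B (x - y) = (indicator B (y - x) :: ennreal)" for x y
    using B(2)[of "x - y"] B(2)[of "y - x"] by (auto simp: indicator_def)
  have shiftM: "(\<integral>\<^sup>+x. f (c + x) \<partial>M) = (\<integral>\<^sup>+x. f x \<partial>M)" if [measurable]: "f \<in> borel_measurable borel" for f :: "'a \<Rightarrow> ennreal" and c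
    by (subst (2) trans[of c, symmetric], subst nn_integral_distr) auto
  have shiftL: "(\<integral>\<^sup>+x. f (c + x) \<partial>lborel) = (\<integral>\<^sup>+x. f x \<partial>lborel)" if [measurable]: "f \<in> borel_measurable borel" for f :: "'a \<Rightarrow> ennreal" and c
    by (subst (2) lborel_distr_plus[of c, symmetric], subst nn_integral_distr) auto
  \<comment> \<open>Both sides are the double integral of \<open>1\<^sub>A(x) 1\<^sub>B(x - y)\<close>; substitute in \<open>y\<close> or in \<open>x\<close>.\<close>
  have "emeasure M A * emeasure lborel B = (\<integral>\<^sup>+x. indicator A x * (\<integral>\<^sup>+y. indicator B y \<partial>lborel) \<partial>M)"
    by (subst nn_integral_multc) (auto simp: M(2))
  also have "\<dots> = (\<integral>\<^sup>+x. indicator A x * (\<integral>\<^sup>+y. indicator B (- x + y) \<partial>lborel) \<partial>M)"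
    by (subst shiftL) auto
  also have "\<dots> = (\<integral>\<^sup>+x. (\<integral>\<^sup>+y. indicator A x * indicator B (x - y) \<partial>lborel) \<partial>M)"
    by (intro nn_integral_cong) (subst nn_integral_cmult, auto simp: symB)
  also have "\<dots> = (\<integral>\<^sup>+y. (\<integral>\<^sup>+x. indicator A x * indicator B (x - y) \<partial>M) \<partial>lborel)"
    by (rule P.Fubini'[symmetric]) measurable
  also have "\<dots> = (\<integral>\<^sup>+y. (\<integral>\<^sup>+x. indicator A (y + x) * indicator B x \<partial>M) \<partial>lborel)"
  proof (rule nn_integral_cong)
    fix y
    show "(\<integral>\<^sup>+x. (indicator A x :: ennreal) * indicator B (x - y) \<partial>M) = (\<integral>\<^sup>+x. indicator A (y + x) * indicator B x \<partial>M)"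
      using shiftM[of "\<lambda>x. (indicator A x :: ennreal) * indicator B (x - y)" y] by simp
  qed
  also have "\<dots> = (\<integral>\<^sup>+x. (\<integral>\<^sup>+y. indicator A (y + x) * indicator B x \<partial>lborel) \<partial>M)"
    by (rule P.Fubini') measurable
  also have "\<dots> = (\<integral>\<^sup>+x. emeasure lborel A * indicator B x \<partial>M)"
  proof (intro nn_integral_cong)
    fix x
    have "(\<integral>\<^sup>+y. indicator A (y + x) * indicator B x \<partial>lborel)
        = (\<integral>\<^sup>+y. indicator A (x + y) \<partial>lborel) * indicator B x"
      by (subst nn_integral_multc) (auto simp: add.commute)
    also have "\<dots> = emeasure lborel A * indicator B x"
      by (subst shiftL) auto
    finally show "(\<integral>\<^sup>+y. indicator A (y + x) * indicator B x \<partial>lborel) = emeasure lborel A * indicator B x" .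
  qed
  also have "\<dots> = emeasure M B * emeasure lborel A"
    by (subst nn_integral_cmult) (auto simp: M(2) mult.commute)
  finally show ?thesis .
qed

text \<open>Since \<open>c + u x = u (x + c / u)\<close>, the image measure is again translation
  invariant, hence a multiple of Lebesgue measure. Rotations map balls to balls of the same radius,
  so the unit ball shows that the factor is 1.\<close>

lemma lborel_distr_rotation:
  fixes u :: complex
  assumes u: "cmod u = 1"
  shows "distr lborel borel ((*) u) = lborel"
proof (rule measure_eqI)
  let ?M = "distr lborel borel ((*) u)"
  have [simp]: "u \<noteq> 0" using u by auto
  have inv: "cmod (inverse u) = 1" using u by (simp add: norm_inverse)
  fix A assume "A \<in> sets ?M"
  then have A[measurable]: "A \<in> sets borel" by simp
  have vim: "(*) u -` ball c r = ball (inverse u * c) r" for c r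
  proof -
    have "dist (inverse u * c) x = dist c (u * x)" for x
    proof -
      have "inverse u * c - x = inverse u * (c - u * x)" by (simp add: field_simps)
      then show ?thesis by (simp only: dist_norm norm_mult inv mult_1)
    qed
    then show ?thesis by auto
  qed
  have ball: "emeasure ?M (ball c r) = emeasure lborel (ball c r)" for c r
    by (cases "r \<ge> 0"; simp add: emeasure_distr vim emeasure_ball ball_empty)
  have "emeasure ?M A * emeasure lborel (ball 0 1 :: complex set) = emeasure ?M (ball 0 1) * emeasure lborel A"
  proof (rule translation_invariant_measure_proportional)
    show "sigma_finite_measure ?M"
    proof
      show "\<exists>A. countable A \<and> A \<subseteq> sets ?M \<and> \<Union> A = space ?M \<and> (\<forall>a\<in>A. emeasure ?M a \<noteq> \<infinity>)"
        by (intro exI[of _ "range (\<lambda>n::nat. ball 0 (real n))"])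
           (auto simp: ball emeasure_ball real_arch_simple reals_Archimedean2)
    qed
    show "distr ?M borel ((+) c) = ?M" for c
    proof -
      have "distr ?M borel ((+) c) = distr lborel borel ((+) c \<circ> (*) u)"
        by (rule distr_distr) auto
      also have "(+) c \<circ> (*) u = (*) u \<circ> (+) (inverse u * c)"
        by (auto simp: algebra_simps)
      also have "distr lborel borel \<dots> = distr (distr lborel borel ((+) (inverse u * c))) borel ((*) u)"
        by (rule distr_distr[symmetric]) auto
      finally show ?thesis by (simp add: lborel_distr_plus)
    qed
  qed auto
  then have eq: "emeasure ?M A * ennreal pi = ennreal pi * emeasure lborel A"
    by (simp add: ball emeasure_ball unit_ball_vol_2)
  show "emeasure ?M A = emeasure lborel A"
    using eq ennreal_mult_cancel_left[of "ennreal pi" "emeasure ?M A" "emeasure lborel A"] by (simp add: mult.commute)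
qed simp

lemma nn_integral_rotation:
  fixes f :: "complex \<Rightarrow> ennreal"
  assumes "cmod u = 1" and [measurable]: "f \<in> borel_measurable borel"
  shows "(\<integral>\<^sup>+z. f (u * z) \<partial>lborel) = (\<integral>\<^sup>+z. f z \<partial>lborel)"
  by (subst (2) lborel_distr_rotation[OF assms(1), symmetric], subst nn_integral_distr) auto

text \<open>Every rotated copy of \<open>f\<close> has the same integral, so integrate over the
  angle and exchange the integrals. It serves on a full circle of angles, for the submean value
  property and for the kernel.\<close>

lemma nn_integral_angular_average:
  fixes f :: "complex \<Rightarrow> ennreal"
  assumes [measurable]: "f \<in> borel_measurable borel" and "a \<le> b"
  shows "ennreal (b - a) * (\<integral>\<^sup>+z. f z \<partial>lborel)
       = (\<integral>\<^sup>+z. (\<integral>\<^sup>+t. f (cis t * z) * indicator {a..b} t \<partial>lborel) \<partial>lborel)"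
proof -
  have [measurable]: "cis \<in> borel_measurable borel"
    by (intro borel_measurable_continuous_onI continuous_intros)
  have "ennreal (b - a) * (\<integral>\<^sup>+z. f z \<partial>lborel)
      = (\<integral>\<^sup>+t. (\<integral>\<^sup>+z. f z \<partial>lborel) * indicator {a..b} t \<partial>lborel)"
    using \<open>a \<le> b\<close> by (subst nn_integral_cmult) (auto simp: mult.commute)
  also have "\<dots> = (\<integral>\<^sup>+t. (\<integral>\<^sup>+z. f (cis t * z) * indicator {a..b} t \<partial>lborel) \<partial>lborel)"
    by (intro nn_integral_cong) (subst nn_integral_multc, auto simp: nn_integral_rotation)
  also have "\<dots> = (\<integral>\<^sup>+z. (\<integral>\<^sup>+t. f (cis t * z) * indicator {a..b} t \<partial>lborel) \<partial>lborel)"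
    by (rule lborel_pair.Fubini'[symmetric]) measurable
  finally show ?thesis .
qed

text \<open>Bridge from the gauge integrals of Cauchy's formula and of the fundamental theorem to
  the nonnegative Lebesgue integrals in which all estimates are made.\<close>

lemma norm_has_integral_le_nn_integral:
  fixes F :: "real \<Rightarrow> 'a::euclidean_space"
  assumes "continuous_on {a..b} F" "(F has_integral I) {a..b}"
  shows "ennreal (norm I) \<le> (\<integral>\<^sup>+t. ennreal (norm (F t)) * indicator {a..b} t \<partial>lborel)"
proof -
  have int: "(\<lambda>t. norm (F t)) integrable_on {a..b}"
    by (intro integrable_continuous_interval continuous_intros assms)
  have "norm I \<le> integral {a..b} (\<lambda>t. norm (F t))"
    using integral_norm_bound_integral[of F "{a..b}" "\<lambda>t. norm (F t)"] int assms(2)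
    by (auto simp: integral_unique has_integral_integrable)
  then show ?thesis
    using nn_integral_has_integral_lebesgue'[of "{a..b}" "\<lambda>t. norm (F t)", OF _ integrable_integral[OF int]]
    by (simp add: ennreal_leI)
qed

section \<open>The submean value property of powers\<close>

text \<open>Cauchy's formula at \<open>w = 0\<close> for \<open>w \<mapsto> F (z + w * v)\<close> on
  the unit circle. The circle is given by a point \<open>v\<close> on it rather than by its radius,
  so that the inequality can next be integrated over \<open>v\<close>.\<close>

lemma circle_submean:
  assumes F: "F holomorphic_on ball z r" and v: "cmod v < r"
  shows "ennreal (2 * pi * cmod (F z)) \<le> (\<integral>\<^sup>+t. ennreal (cmod (F (z + cis t * v))) * indicator {0..2*pi} t \<partial>lborel)"
proof -
  define G where "G w = F (z + w * v)" for w
  have sub: "z + w * v \<in> ball z r" if "w \<in> cball 0 1" for w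
  proof -
    have "cmod w * cmod v \<le> 1 * cmod v"
      using that by (intro mult_right_mono) auto
    then show ?thesis using v by (simp add: dist_norm norm_mult)
  qed
  have "G holomorphic_on cball 0 1"
    unfolding G_def using sub
    by (intro holomorphic_on_compose_gen[OF _ F, unfolded o_def] holomorphic_intros) auto
  then have "((\<lambda>u. G u / (u - 0)) has_contour_integral (2 * pi * \<i> * G 0)) (circlepath 0 1)"
    using Cauchy_integral_circlepath_simple[of G 0 1 0] by simp
  then have "((\<lambda>t. G (cis t) / cis t * \<i> * cis t) has_integral (2 * pi * \<i> * G 0)) {0..2*pi}"
    unfolding circlepath_def by (subst (asm) has_contour_integral_part_circlepath_iff) auto
  then have "((\<lambda>t. G (cis t) * \<i>) has_integral (2 * pi * \<i> * G 0)) {0..2*pi}"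
    by (simp add: field_simps)
  moreover have "continuous_on {0..2*pi} (\<lambda>t. G (cis t) * \<i>)"
    unfolding G_def
    by (intro continuous_on_compose2[OF holomorphic_on_imp_continuous_on[OF F]] continuous_intros)
       (use sub in auto)
  ultimately show ?thesis
    using norm_has_integral_le_nn_integral[of 0 "2*pi" "\<lambda>t. G (cis t) * \<i>"]
    by (fastforce simp: norm_mult G_def)
qed

lemma area_submean:
  assumes F: "F holomorphic_on ball z r" and r: "r \<ge> 0"
  shows "ennreal (pi * r\<^sup>2 * cmod (F z)) \<le> (\<integral>\<^sup>+w. ennreal (cmod (F w)) * indicator (ball z r) w \<partial>lborel)"
proof -
  define f where "f w = ennreal (cmod (F w)) * indicator (ball z r) w" for w
  have "(\<lambda>w. indicator (ball z r) w *\<^sub>R cmod (F w)) \<in> borel_measurable borel"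
    by (intro borel_measurable_continuous_on_indicator continuous_intros holomorphic_on_imp_continuous_on[OF F]) auto
  then have "(\<lambda>w. ennreal (indicator (ball z r) w *\<^sub>R cmod (F w))) \<in> borel_measurable borel"
    by measurable
  also have "(\<lambda>w. ennreal (indicator (ball z r) w *\<^sub>R cmod (F w))) = f"
    by (auto simp: f_def indicator_def)
  finally have f[measurable]: "f \<in> borel_measurable borel" .
  \<comment> \<open>The extra factor \<open>2 * pi\<close> is the length of the angular interval; it
    cancels once the average over rotations is undone.\<close>
  have "ennreal (2*pi) * ennreal (pi * r\<^sup>2 * cmod (F z)) = ennreal (2 * pi * cmod (F z)) * ennreal (pi * r\<^sup>2)"
    by (simp flip: ennreal_mult add: mult_ac)
  also have "\<dots> = (\<integral>\<^sup>+v. ennreal (2 * pi * cmod (F z)) * indicator (ball 0 r) (v::complex) \<partial>lborel)"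
    using r by (subst nn_integral_cmult_indicator) (auto simp: emeasure_ball unit_ball_vol_2)
  also have "\<dots> \<le> (\<integral>\<^sup>+v. (\<integral>\<^sup>+t. f (z + cis t * v) * indicator {0..2*pi} t \<partial>lborel) \<partial>lborel)"
  proof (intro nn_integral_mono)
    fix v :: complex
    show "ennreal (2 * pi * cmod (F z)) * indicator (ball 0 r) v
        \<le> (\<integral>\<^sup>+t. f (z + cis t * v) * indicator {0..2*pi} t \<partial>lborel)"
    proof (cases "v \<in> ball 0 r")
      case True
      then have "z + cis t * v \<in> ball z r" for t
        by (simp add: dist_norm norm_mult)
      then show ?thesis
        using circle_submean[OF F, of v] True by (simp add: f_def)
    qed simp
  qed
  also have "\<dots> = ennreal (2*pi) * (\<integral>\<^sup>+v. f (z + v) \<partial>lborel)"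
    using nn_integral_angular_average[of "\<lambda>v. f (z + v)" 0 "2*pi"] by simp
  also have "(\<integral>\<^sup>+v. f (z + v) \<partial>lborel) = (\<integral>\<^sup>+v. f v \<partial>lborel)"
    by (subst (2) lborel_distr_plus[of z, symmetric], subst nn_integral_distr) auto
  finally show ?thesis
    by (simp add: f_def ennreal_mult_le_mult_iff)
qed

lemma borel_measurable_cmod_powr_on_open:
  assumes "continuous_on S F" "open S"
  shows "(\<lambda>w. ennreal (cmod (F w) powr p) * indicator S w) \<in> borel_measurable borel"
proof -
  have "(\<lambda>w. indicator S w *\<^sub>R F w) \<in> borel_measurable borel"
    using assms by (intro borel_measurable_continuous_on_indicator) auto
  then have "(\<lambda>w. ennreal (cmod (indicator S w *\<^sub>R F w) powr p) * indicator S w) \<in> borel_measurable borel"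
    using borel_open[OF assms(2)] by measurable
  also have "(\<lambda>w. ennreal (cmod (indicator S w *\<^sub>R F w) powr p) * indicator S w)
      = (\<lambda>w. ennreal (cmod (F w) powr p) * indicator S w)"
    by (auto simp: indicator_def)
  finally show ?thesis .
qed

text \<open>If \<open>x > c\<close>, then \<open>x \<le> x * (x / c) powr (p - 1)\<close>. The free
  parameter \<open>c\<close> makes this a substitute for Jensen's and Hoelder's inequalities: it is
  chosen so that the two terms balance after integration.\<close>

lemma le_add_powr_interpolation:
  fixes x c p :: real
  assumes "p \<ge> 1" "c > 0" "x \<ge> 0"
  shows "x \<le> c + c powr (1 - p) * x powr p"
proof (cases "x \<le> c")
  case True
  then show ?thesis by (smt (verit) assms mult_nonneg_nonneg powr_ge_zero)
next
  case False
  then have "1 \<le> (x / c) powr (p - 1)"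
    using assms by (intro ge_one_powr_ge_zero) auto
  then have "x * 1 \<le> x * (x / c) powr (p - 1)"
    using assms by (intro mult_left_mono) auto
  also have "\<dots> = c powr (1 - p) * x powr p"
    using assms False by (simp add: powr_divide powr_diff field_simps)
  finally show ?thesis using assms by simp
qed

lemma area_submean_powr_ge_1:
  assumes F: "F holomorphic_on ball z r" and r: "r > 0" and p: "p \<ge> 1"
  shows "ennreal (r\<^sup>2 * cmod (F z) powr p)
       \<le> ennreal (2 powr p) * (\<integral>\<^sup>+w. ennreal (cmod (F w) powr p) * indicator (ball z r) w \<partial>lborel)"
proof (cases "F z = 0")
  case False
  \<comment> \<open>With this \<open>c\<close> the constant term integrates to exactly half of the
    left-hand side of the case \<open>p = 1\<close> and can be absorbed there.\<close>
  define c where "c = cmod (F z) / 2"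
  have c: "c > 0" using False by (simp add: c_def)
  let ?I = "\<integral>\<^sup>+w. ennreal (cmod (F w) powr p) * indicator (ball z r) w \<partial>lborel"
  note [measurable] = borel_measurable_cmod_powr_on_open[OF holomorphic_on_imp_continuous_on[OF F] open_ball, of p]
  have "ennreal (pi * r\<^sup>2 * cmod (F z)) \<le> (\<integral>\<^sup>+w. ennreal (cmod (F w)) * indicator (ball z r) w \<partial>lborel)"
    using area_submean[OF F] r by simp
  also have "\<dots> \<le> (\<integral>\<^sup>+w. ennreal c * indicator (ball z r) w
      + ennreal (c powr (1 - p)) * (ennreal (cmod (F w) powr p) * indicator (ball z r) w) \<partial>lborel)"
    using le_add_powr_interpolation[OF p c] c
    by (intro nn_integral_mono) (auto simp: indicator_def simp flip: ennreal_mult ennreal_plus intro!: ennreal_leI)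
  also have "\<dots> = ennreal c * ennreal (pi * r\<^sup>2) + ennreal (c powr (1 - p)) * ?I"
    using r by (subst nn_integral_add) (auto simp: nn_integral_cmult nn_integral_cmult_indicator emeasure_ball unit_ball_vol_2
        intro!: borel_measurable_times_ennreal borel_measurable_indicator)
  finally have le: "ennreal (pi * r\<^sup>2 * cmod (F z)) \<le> ennreal (c * (pi * r\<^sup>2)) + ennreal (c powr (1 - p)) * ?I"
    using c by (simp add: ennreal_mult)
  show ?thesis
  proof (cases ?I)
    case (real J)
    have "pi * r\<^sup>2 * cmod (F z) \<le> c * (pi * r\<^sup>2) + c powr (1 - p) * J"
      using le real c by (simp flip: ennreal_mult ennreal_plus) 
    then have "pi * r\<^sup>2 * c \<le> c powr (1 - p) * J"
      by (simp add: c_def field_simps)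
    then have "pi * (r\<^sup>2 * c powr p) \<le> J"
      using c by (simp add: powr_diff field_simps)
    moreover have "1 * (r\<^sup>2 * c powr p) \<le> pi * (r\<^sup>2 * c powr p)"
      using pi_gt3 by (intro mult_right_mono) auto
    ultimately have "r\<^sup>2 * c powr p \<le> J" by simp
    moreover have "c powr p = cmod (F z) powr p / 2 powr p"
      by (simp add: c_def powr_divide)
    ultimately have "r\<^sup>2 * cmod (F z) powr p \<le> 2 powr p * J"
      by (simp add: field_simps)
    then show ?thesis using real by (simp flip: ennreal_mult)
  next
    case top
    then show ?thesis by (simp add: ennreal_mult_top)
  qed
qed simp

text \<open>The point maximizing \<open>(r - |w - z|)\<^bsup>2/p\<^esup> |F w|\<close> has a neighbourhood on which \<open>|F|\<close> is
  comparable to its value there, so the case \<open>p = 1\<close> applies after factoring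
  \<open>|F| = |F|\<^sup>p |F|\<^bsup>1-p\<^esup>\<close>.\<close>

lemma area_submean_powr_less_1:
  assumes F: "F holomorphic_on S" "cball z r \<subseteq> S" and r: "r > 0" and p: "0 < p" "p < 1"
  shows "ennreal (r\<^sup>2 * cmod (F z) powr p)
       \<le> ennreal (4 * 4 powr (1 / p)) * (\<integral>\<^sup>+w. ennreal (cmod (F w) powr p) * indicator (ball z r) w \<partial>lborel)"
proof (cases "F z = 0")
  case False
  \<comment> \<open>The exponent \<open>2 / p\<close> is chosen so that \<open>?G z powr p\<close>
    is the quantity \<open>r^2 * |F z|^p\<close> to be estimated.\<close>
  let ?G = "\<lambda>w. (r - dist z w) powr (2 / p) * cmod (F w)"
  let ?I = "\<integral>\<^sup>+w. ennreal (cmod (F w) powr p) * indicator (ball z r) w \<partial>lborel"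
  have contF: "continuous_on (cball z r) F"
    using F by (intro holomorphic_on_imp_continuous_on holomorphic_on_subset[OF F(1)])
  have "continuous_on (cball z r) ?G"
    using p by (intro continuous_intros continuous_on_powr' contF) auto
  \<comment> \<open>Existence of the maximum rests on compactness, which is why \<open>F\<close> is
    holomorphic on a set containing the closed ball.\<close>
  then obtain w0 where w0: "w0 \<in> cball z r" "\<And>w. w \<in> cball z r \<Longrightarrow> ?G w \<le> ?G w0"
    using continuous_attains_sup[of "cball z r" ?G] r by auto
  \<comment> \<open>A positive maximum keeps \<open>w0\<close> off the bounding circle, where the
    weight vanishes, and makes \<open>F w0\<close> nonzero.\<close>
  have "0 < ?G z" using False r by simp
  also have "\<dots> \<le> ?G w0" using w0(2)[of z] r by simp
  finally have pos: "?G w0 > 0" .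
  \<comment> \<open>Half the distance from \<open>w0\<close> to the bounding circle: on
    \<open>ball w0 \<rho>\<close> the weight \<open>r - dist z w\<close> is at least half its value
    at \<open>w0\<close>, so maximality gives \<open>|F| \<le> 2^(2/p) * m\<close> there.\<close>
  define \<rho> where "\<rho> = (r - dist z w0) / 2"
  define m where "m = cmod (F w0)"
  have m: "m > 0" using pos by (auto simp: m_def zero_less_mult_iff)
  have \<rho>: "\<rho> > 0" using pos w0(1) by (auto simp: \<rho>_def zero_less_mult_iff)
  have dist_w0: "r - dist z w0 = 2 * \<rho>" by (simp add: \<rho>_def)
  have far: "r - dist z w \<ge> \<rho>" if "w \<in> ball w0 \<rho>" for w
    using that dist_triangle[of z w w0] dist_w0 by (simp add: dist_commute)
  then have sub: "ball w0 \<rho> \<subseteq> ball z r" using \<rho> by fastforce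
  have Fw: "cmod (F w) \<le> 2 powr (2/p) * m" if w: "w \<in> ball w0 \<rho>" for w
  proof -
    have "\<rho> powr (2/p) * cmod (F w) \<le> ?G w"
      using far[OF w] \<rho> p by (intro mult_right_mono powr_mono2) auto
    also have "\<dots> \<le> ?G w0" using w sub by (intro w0(2)) auto
    also have "\<dots> = \<rho> powr (2/p) * (2 powr (2/p) * m)"
      using \<rho> by (simp add: dist_w0 m_def powr_mult)
    finally show ?thesis using \<rho> by simp
  qed
  \<comment> \<open>Bound for \<open>|F|^(1-p)\<close> near \<open>w0\<close>. It carries
    \<open>m^(1-p)\<close>, so dividing the submean inequality for \<open>|F|\<close> by it leaves
    \<open>m^p\<close>.\<close>
  define K where "K = (2 powr (2/p) * m) powr (1 - p)"
  note [measurable] = borel_measurable_cmod_powr_on_open[OF continuous_on_subset[OF contF ball_subset_cball] open_ball, of p]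
  have "ennreal (pi * \<rho>\<^sup>2 * m) \<le> (\<integral>\<^sup>+w. ennreal (cmod (F w)) * indicator (ball w0 \<rho>) w \<partial>lborel)"
    unfolding m_def using \<rho> sub F(2) ball_subset_cball[of z r]
    by (intro area_submean holomorphic_on_subset[OF F(1)]) (blast, simp)
  also have "\<dots> \<le> (\<integral>\<^sup>+w. ennreal K * (ennreal (cmod (F w) powr p) * indicator (ball z r) w) \<partial>lborel)"
  proof (intro nn_integral_mono)
    fix w
    show "ennreal (cmod (F w)) * indicator (ball w0 \<rho>) w \<le> ennreal K * (ennreal (cmod (F w) powr p) * indicator (ball z r) w)"
    proof (cases "w \<in> ball w0 \<rho>")
      case True
      have "cmod (F w) = cmod (F w) powr (1 - p) * cmod (F w) powr p"
        by (simp flip: powr_add)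
      also have "\<dots> \<le> K * cmod (F w) powr p"
        unfolding K_def using Fw[OF True] p by (intro mult_right_mono powr_mono2) auto
      finally have "ennreal (cmod (F w)) \<le> ennreal (K * cmod (F w) powr p)" by (rule ennreal_leI)
      then show ?thesis using True sub by (auto simp: ennreal_mult K_def)
    qed simp
  qed
  also have "\<dots> = ennreal K * ?I"
    by (rule nn_integral_cmult) measurable
  finally have le: "ennreal (pi * \<rho>\<^sup>2 * m) \<le> ennreal K * ?I" .
  show ?thesis
  proof (cases ?I)
    case (real J)
    have K: "K = 4 powr (1/p) / 4 * (m / m powr p)"
    proof -
      have "K = 2 powr (2/p * (1 - p)) * m powr (1 - p)"
        using m by (simp add: K_def powr_mult powr_powr)
      also have "2/p * (1 - p) = 2 * (1/p) - 2" using p by (simp add: field_simps)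
      also have "2 powr (2 * (1/p) - 2) = (2 powr 2) powr (1/p) / (2 powr 2 :: real)"
        unfolding powr_diff powr_powr ..
      finally show ?thesis using m by (simp add: powr_diff)
    qed
    have "pi * \<rho>\<^sup>2 * m \<le> K * J"
      using le real by (simp add: K_def flip: ennreal_mult)
    then have "pi * \<rho>\<^sup>2 * m powr p \<le> 4 powr (1/p) / 4 * J"
      using m unfolding K by (simp add: field_simps)
    moreover have "1 * (\<rho>\<^sup>2 * m powr p) \<le> pi * (\<rho>\<^sup>2 * m powr p)"
      using pi_gt3 by (intro mult_right_mono) auto
    ultimately have 1: "\<rho>\<^sup>2 * m powr p \<le> 4 powr (1/p) / 4 * J" by simp
    have G_powr: "?G w powr p = (r - dist z w)\<^sup>2 * cmod (F w) powr p" if "w \<in> cball z r" for w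
      using that p by (simp add: powr_mult powr_powr)
    have "r\<^sup>2 * cmod (F z) powr p = ?G z powr p" using G_powr[of z] r by simp
    also have "\<dots> \<le> ?G w0 powr p" using w0(2)[of z] r p by (intro powr_mono2) auto
    also have "\<dots> = 4 * (\<rho>\<^sup>2 * m powr p)" 
      using G_powr[OF w0(1)] by (simp add: dist_w0 m_def power2_eq_square)
    also have "\<dots> \<le> 4 powr (1/p) * J" using 1 by simp
    also have "\<dots> \<le> 4 * 4 powr (1/p) * J" using real by simp
    finally show ?thesis using real by (simp flip: ennreal_mult)
  next
    case top
    then show ?thesis by (simp add: ennreal_mult_top)
  qed
qed simp

text \<open>The constant is fixed before \<open>F\<close>, \<open>z\<close> and \<open>r\<close>:
  later the inequality is integrated over a family of discs of varying centre and radius.\<close>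

lemma area_submean_powr:
  assumes p: "0 < p"
  obtains C :: real where "C > 0"
    "\<And>F S z r. \<lbrakk>F holomorphic_on S; cball z r \<subseteq> S; r > 0\<rbrakk> \<Longrightarrow>
       ennreal (r\<^sup>2 * cmod (F z) powr p)
       \<le> ennreal C * (\<integral>\<^sup>+w. ennreal (cmod (F w) powr p) * indicator (ball z r) w \<partial>lborel)"
proof (cases "p < 1")
  case True
  show ?thesis
    by (rule that[of "4 * 4 powr (1 / p)"]) (use area_submean_powr_less_1 p True in auto)
next
  case False
  show ?thesis
  proof (rule that[of "2 powr p"])
    show "ennreal (r\<^sup>2 * cmod (F z) powr p)
       \<le> ennreal (2 powr p) * (\<integral>\<^sup>+w. ennreal (cmod (F w) powr p) * indicator (ball z r) w \<partial>lborel)"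
      if "F holomorphic_on S" "cball z r \<subseteq> S" "r > 0" for F S z r
      using that False ball_subset_cball[of z r]
      by (intro area_submean_powr_ge_1 holomorphic_on_subset[OF that(1)]) (blast, auto)
  qed simp
qed

section \<open>Growth of functions in Dirichlet spaces\<close>

lemma sets_weighted_area [measurable_cong]: "sets (weighted_area \<beta>) = sets (restrict_space borel unit_disc)"
  by (simp add: weighted_area_def disc_area_def cong: sets_restrict_space_cong)

lemma space_weighted_area [simp]: "space (weighted_area \<beta>) = unit_disc"
  by (simp add: weighted_area_def disc_area_def space_restrict_space space_scale_measure)

lemma borel_measurable_weighted_area_continuous:
  fixes f :: "complex \<Rightarrow> 'a::topological_space"
  assumes "continuous_on unit_disc f"
  shows "f \<in> borel_measurable (weighted_area \<beta>)"
proof -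
  have "f \<in> borel_measurable (restrict_space borel unit_disc)"
    by (rule borel_measurable_continuous_on_restrict[OF assms])
  then show ?thesis by measurable
qed

lemma nn_integral_weighted_area:
  fixes f :: "complex \<Rightarrow> ennreal"
  assumes "f \<in> borel_measurable (restrict_space borel unit_disc)"
  shows "(\<integral>\<^sup>+z. f z \<partial>weighted_area \<beta>)
       = ennreal (1 / pi) * (\<integral>\<^sup>+z. ennreal ((1 - (cmod z)\<^sup>2) powr \<beta>) * f z * indicator unit_disc z \<partial>lborel)"
proof -
  have [measurable]: "f \<in> borel_measurable (restrict_space lborel unit_disc)"
    using assms by (simp cong: measurable_cong_sets sets_restrict_space_cong)
  have [measurable]: "(\<lambda>z. ennreal ((1 - (cmod z)\<^sup>2) powr \<beta>)) \<in> borel_measurable (restrict_space lborel unit_disc)"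
    by (intro measurable_restrict_space1) measurable
  have [measurable_cong]: "sets disc_area = sets (restrict_space lborel unit_disc)"
    by (simp add: disc_area_def)
  have "(\<integral>\<^sup>+z. f z \<partial>weighted_area \<beta>) = (\<integral>\<^sup>+z. ennreal ((1 - (cmod z)\<^sup>2) powr \<beta>) * f z \<partial>disc_area)"
    unfolding weighted_area_def by (intro nn_integral_density) measurable
  also have "\<dots> = ennreal (1/pi) * (\<integral>\<^sup>+z. ennreal ((1 - (cmod z)\<^sup>2) powr \<beta>) * f z \<partial>restrict_space lborel unit_disc)"
    unfolding disc_area_def by (intro nn_integral_scale_measure) measurable
  also have "(\<integral>\<^sup>+z. ennreal ((1 - (cmod z)\<^sup>2) powr \<beta>) * f z \<partial>restrict_space lborel unit_disc)
    = (\<integral>\<^sup>+z. ennreal ((1 - (cmod z)\<^sup>2) powr \<beta>) * f z * indicator unit_disc z \<partial>lborel)"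
    by (rule nn_integral_restrict_space) auto
  finally show ?thesis .
qed

lemma continuous_on_deriv_disc:
  "f holomorphic_on unit_disc \<Longrightarrow> continuous_on unit_disc (deriv f)"
  by (intro holomorphic_on_imp_continuous_on holomorphic_deriv) auto

lemma cmod_square_less_1: "z \<in> unit_disc \<Longrightarrow> (cmod z)\<^sup>2 < 1"
  by (simp add: power_less_one_iff abs_square_less_1)

lemma dirichlet_integral_lborel:
  assumes "f holomorphic_on unit_disc"
  shows "dirichlet_integral \<alpha> p f
       = ennreal (1 / pi) * (\<integral>\<^sup>+z. ennreal ((1 - (cmod z)\<^sup>2) powr \<alpha> * cmod (deriv f z) powr p) * indicator unit_disc z \<partial>lborel)"
proof -
  have "continuous_on unit_disc (deriv f)"
    by (rule continuous_on_deriv_disc[OF assms])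
  then have [measurable]: "deriv f \<in> borel_measurable (restrict_space borel unit_disc)"
    by (rule borel_measurable_continuous_on_restrict)
  show ?thesis
    unfolding dirichlet_integral_def by (subst nn_integral_weighted_area) (auto simp: ennreal_mult)
qed

section \<open>Submean estimates for derivatives against the radial weight\<close>

lemma powr_comparable:
  fixes x y a :: real
  assumes "0 < x" "0 < y" "y \<le> 3 * x" "x \<le> 3 * y"
  shows "y powr a \<le> 3 powr \<bar>a\<bar> * x powr a"
proof -
  have "(y / x) powr a \<le> 3 powr \<bar>a\<bar>"
  proof (cases "a \<ge> 0")
    case True
    then show ?thesis using assms by (auto intro!: powr_mono2 simp: field_simps)
  next
    case False
    have "(y / x) powr a = (x / y) powr (- a)"
      using assms by (simp add: powr_minus powr_divide field_simps)
    also have "\<dots> \<le> 3 powr (- a)"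
      using False assms by (intro powr_mono2) (auto simp: field_simps)
    finally show ?thesis using False by simp
  qed
  then show ?thesis using assms by (simp add: powr_divide field_simps)
qed

text \<open>On such a disc \<open>1 - |w|\<close> lies between \<open>1/2\<close> and
  \<open>3/2\<close> times \<open>1 - |z|\<close>, while \<open>1 - |w|^2\<close> lies between
  \<open>1 - |w|\<close> and \<open>2 (1 - |w|)\<close>. The symmetric constant 3 suits
  \<open>powr_comparable\<close>; the sharper 2 locates the radii whose discs contain a given
  \<open>w\<close>.\<close>

lemma defect_comparable:
  fixes z w :: complex
  assumes z: "z \<in> unit_disc" and w: "dist z w < (1 - cmod z) / 2"
  shows "cmod w < 1" "1 - cmod z \<le> 3 * (1 - (cmod w)\<^sup>2)" "1 - (cmod w)\<^sup>2 \<le> 3 * (1 - cmod z)"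
    "1 - cmod z \<le> 2 * (1 - (cmod w)\<^sup>2)"
proof -
  have m: "1 - cmod w < 3/2 * (1 - cmod z)" "1 - cmod w > (1 - cmod z) / 2"
    using w norm_triangle_ineq2[of z w] norm_triangle_ineq2[of w z]
    by (auto simp: dist_norm norm_minus_commute)
  with z show 1: "cmod w < 1" by auto
  have eq: "1 - (cmod w)\<^sup>2 = (1 - cmod w) * (1 + cmod w)" by (simp add: power2_eq_square algebra_simps)
  have "(1 - cmod w) * 1 \<le> 1 - (cmod w)\<^sup>2"
    unfolding eq using 1 by (intro mult_left_mono) auto
  moreover have "1 - (cmod w)\<^sup>2 \<le> (1 - cmod w) * 2"
    unfolding eq using 1 by (intro mult_left_mono) auto
  ultimately show "1 - cmod z \<le> 3 * (1 - (cmod w)\<^sup>2)" "1 - (cmod w)\<^sup>2 \<le> 3 * (1 - cmod z)"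
    "1 - cmod z \<le> 2 * (1 - (cmod w)\<^sup>2)"
    using m z by auto
qed

lemma deriv_submean:
  assumes p: "0 < p"
  obtains C :: real where "C > 0"
    "\<And>f z. \<lbrakk>f holomorphic_on unit_disc; z \<in> unit_disc\<rbrakk> \<Longrightarrow>
       ennreal ((1 - cmod z)\<^sup>2 * cmod (deriv f z) powr p)
       \<le> ennreal C * (\<integral>\<^sup>+w. ennreal (cmod (deriv f w) powr p) * indicator (ball z ((1 - cmod z) / 2)) w \<partial>lborel)"
proof -
  obtain C where C: "C > 0" "\<And>F S z r. \<lbrakk>F holomorphic_on S; cball z r \<subseteq> S; r > 0\<rbrakk> \<Longrightarrow>
       ennreal (r\<^sup>2 * cmod (F z) powr p)
       \<le> ennreal C * (\<integral>\<^sup>+w. ennreal (cmod (F w) powr p) * indicator (ball z r) w \<partial>lborel)"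
    by (rule area_submean_powr[OF p]) (rule that)
  show ?thesis
  \<comment> \<open>The 4 comes from squaring the radius \<open>(1 - cmod z) / 2\<close>.\<close>
  proof (rule that[of "4 * C"])
    fix f and z :: complex assume f: "f holomorphic_on unit_disc" and z: "z \<in> unit_disc"
    define r where "r = (1 - cmod z) / 2"
    have r: "r > 0" using z by (simp add: r_def)
    have "cball z r \<subseteq> unit_disc"
    proof
      fix w assume "w \<in> cball z r"
      then show "w \<in> unit_disc"
        using norm_triangle_ineq2[of w z] z by (simp add: r_def dist_norm norm_minus_commute)
    qed
    moreover have "deriv f holomorphic_on unit_disc" using f by (rule holomorphic_deriv) simp
    ultimately have *: "ennreal 4 * ennreal (r\<^sup>2 * cmod (deriv f z) powr p)
        \<le> ennreal 4 * (ennreal C * (\<integral>\<^sup>+w. ennreal (cmod (deriv f w) powr p) * indicator (ball z r) w \<partial>lborel))"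
      using r by (intro mult_left_mono C(2)) auto
    then show "ennreal ((1 - cmod z)\<^sup>2 * cmod (deriv f z) powr p)
       \<le> ennreal (4 * C) * (\<integral>\<^sup>+w. ennreal (cmod (deriv f w) powr p) * indicator (ball z ((1 - cmod z) / 2)) w \<partial>lborel)"
    proof -
      have "ennreal 4 * ennreal (r\<^sup>2 * cmod (deriv f z) powr p) = ennreal ((1 - cmod z)\<^sup>2 * cmod (deriv f z) powr p)"
        by (subst ennreal_mult[symmetric]) (auto simp: r_def power_divide)
      moreover have "ennreal (4 * C) = ennreal 4 * ennreal C"
        using C(1) by (intro ennreal_mult) auto
      ultimately show ?thesis using * by (simp add: mult.assoc flip: r_def)
    qed
  qed (use C in simp)
qed

text \<open>Two powers of \<open>1 - |z|\<close> come from the area of the disc in the submean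
  inequality. The other \<open>\<alpha>\<close> come from the weight, which on that disc is
  comparable to the constant \<open>(1 - |z|)^\<alpha>\<close> and can be moved under the
  integral.\<close>

lemma deriv_growth:
  assumes p: "0 < p"
  obtains C :: real where "C > 0"
    "\<And>f z. \<lbrakk>f holomorphic_on unit_disc; z \<in> unit_disc\<rbrakk> \<Longrightarrow>
       ennreal ((1 - cmod z) powr (\<alpha> + 2) * cmod (deriv f z) powr p) \<le> ennreal C * dirichlet_integral \<alpha> p f"
proof -
  obtain C where C: "C > 0" "\<And>f z. \<lbrakk>f holomorphic_on unit_disc; z \<in> unit_disc\<rbrakk> \<Longrightarrow>
       ennreal ((1 - cmod z)\<^sup>2 * cmod (deriv f z) powr p)
       \<le> ennreal C * (\<integral>\<^sup>+w. ennreal (cmod (deriv f w) powr p) * indicator (ball z ((1 - cmod z) / 2)) w \<partial>lborel)"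
    by (rule deriv_submean[OF p]) (rule that)
  show ?thesis
  proof (rule that[of "C * 3 powr \<bar>\<alpha>\<bar> * pi"])
    fix f and z :: complex assume f: "f holomorphic_on unit_disc" and z: "z \<in> unit_disc"
    define y where "y = 1 - cmod z"
    have y: "y > 0" using z by (simp add: y_def)
    let ?W = "\<lambda>w. ennreal ((1 - (cmod w)\<^sup>2) powr \<alpha> * cmod (deriv f w) powr p) * indicator unit_disc w"
    have "continuous_on unit_disc (deriv f)"
      by (rule continuous_on_deriv_disc[OF f])
    then have "(\<lambda>w. ennreal (cmod (deriv f w) powr p) * indicator unit_disc w) \<in> borel_measurable borel"
      by (intro borel_measurable_cmod_powr_on_open) auto
    then have "(\<lambda>w. ennreal ((1 - (cmod w)\<^sup>2) powr \<alpha>) * (ennreal (cmod (deriv f w) powr p) * indicator unit_disc w)) \<in> borel_measurable borel"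
      by measurable
    then have [measurable]: "?W \<in> borel_measurable borel"
      by (simp add: ennreal_mult mult.assoc)
    have "ennreal (y powr \<alpha>) * (\<integral>\<^sup>+w. ennreal (cmod (deriv f w) powr p) * indicator (ball z (y / 2)) w \<partial>lborel)
        = (\<integral>\<^sup>+w. ennreal (y powr \<alpha>) * (ennreal (cmod (deriv f w) powr p) * indicator (ball z (y / 2)) w) \<partial>lborel)"
    proof (rule nn_integral_cmult[symmetric])
      have "ball z (y/2) \<subseteq> unit_disc"
        using defect_comparable(1)[OF z] by (auto simp: y_def)
      then have "continuous_on (ball z (y/2)) (deriv f)"
        using \<open>continuous_on unit_disc (deriv f)\<close> continuous_on_subset by blast
      then show "(\<lambda>w. ennreal (cmod (deriv f w) powr p) * indicator (ball z (y / 2)) w) \<in> borel_measurable lborel"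
        using borel_measurable_cmod_powr_on_open[OF _ open_ball] by simp
    qed
    also have "\<dots> \<le> (\<integral>\<^sup>+w. ennreal (3 powr \<bar>\<alpha>\<bar>) * ?W w \<partial>lborel)"
    proof (intro nn_integral_mono)
      fix w
      show "ennreal (y powr \<alpha>) * (ennreal (cmod (deriv f w) powr p) * indicator (ball z (y / 2)) w)
        \<le> ennreal (3 powr \<bar>\<alpha>\<bar>) * ?W w"
      proof (cases "dist z w < y / 2")
        case True
        note d = defect_comparable[OF z True[unfolded y_def]]
        have "y powr \<alpha> \<le> 3 powr \<bar>\<alpha>\<bar> * (1 - (cmod w)\<^sup>2) powr \<alpha>"
          using d y by (intro powr_comparable) (auto simp: y_def)
        then have "y powr \<alpha> * cmod (deriv f w) powr p \<le> 3 powr \<bar>\<alpha>\<bar> * (1 - (cmod w)\<^sup>2) powr \<alpha> * cmod (deriv f w) powr p"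
          by (intro mult_right_mono) auto
        then have "ennreal (y powr \<alpha> * cmod (deriv f w) powr p)
          \<le> ennreal (3 powr \<bar>\<alpha>\<bar> * ((1 - (cmod w)\<^sup>2) powr \<alpha> * cmod (deriv f w) powr p))"
          by (intro ennreal_leI) (simp add: mult.assoc)
        then show ?thesis using d(1) True by (simp add: ennreal_mult)
      qed simp
    qed
    also have "\<dots> = ennreal (3 powr \<bar>\<alpha>\<bar>) * (\<integral>\<^sup>+w. ?W w \<partial>lborel)"
      by (rule nn_integral_cmult) measurable
    also have "(\<integral>\<^sup>+w. ?W w \<partial>lborel) = ennreal pi * dirichlet_integral \<alpha> p f"
    proof -
      have "ennreal pi * ennreal (1 / pi) = 1" by (simp flip: ennreal_mult)
      then show ?thesis by (simp add: dirichlet_integral_lborel[OF f] flip: mult.assoc)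
    qed
    finally have *: "ennreal (y powr \<alpha>) * (\<integral>\<^sup>+w. ennreal (cmod (deriv f w) powr p) * indicator (ball z (y / 2)) w \<partial>lborel)
      \<le> ennreal (3 powr \<bar>\<alpha>\<bar>) * (ennreal pi * dirichlet_integral \<alpha> p f)" .
    have "ennreal (y powr (\<alpha> + 2) * cmod (deriv f z) powr p) = ennreal (y powr \<alpha>) * ennreal (y\<^sup>2 * cmod (deriv f z) powr p)"
      using y by (simp add: powr_add mult.assoc flip: ennreal_mult)
    also have "\<dots> \<le> ennreal (y powr \<alpha>) * (ennreal C * (\<integral>\<^sup>+w. ennreal (cmod (deriv f w) powr p) * indicator (ball z (y / 2)) w \<partial>lborel))"
      unfolding y_def by (intro mult_left_mono C f z) auto
    also have "\<dots> \<le> ennreal C * (ennreal (3 powr \<bar>\<alpha>\<bar>) * (ennreal pi * dirichlet_integral \<alpha> p f))"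
      using mult_left_mono[OF *, of "ennreal C"] by (simp add: mult_ac)
    also have "\<dots> = ennreal (C * 3 powr \<bar>\<alpha>\<bar> * pi) * dirichlet_integral \<alpha> p f"
      using C(1) by (simp add: ennreal_mult mult.assoc)
    finally show "ennreal ((1 - cmod z) powr (\<alpha> + 2) * cmod (deriv f z) powr p)
      \<le> ennreal (C * 3 powr \<bar>\<alpha>\<bar> * pi) * dirichlet_integral \<alpha> p f"
      by (simp add: y_def)
  qed (use C in simp)
qed

lemma dirichlet_norm_le_1:
  assumes p: "0 < p" and f: "f \<in> dirichlet_space \<alpha> p" "dirichlet_norm \<alpha> p f \<le> 1"
  shows "cmod (f 0) \<le> 1" "dirichlet_integral \<alpha> p f \<le> 1"
proof -
  define I where "I = enn2real (dirichlet_integral \<alpha> p f)"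
  \<comment> \<open>Membership in the space makes the integral finite, so \<open>enn2real\<close>
    loses nothing here.\<close>
  have I: "I \<ge> 0" "dirichlet_integral \<alpha> p f = ennreal I"
    using f(1) by (auto simp: I_def dirichlet_space_def less_top)
  have "cmod (f 0) powr p + I = dirichlet_norm \<alpha> p f powr p"
    using p I(1) by (simp add: dirichlet_norm_def I_def powr_powr)
  also have "\<dots> \<le> 1 powr p"
    using f(2) p by (intro powr_mono2) (auto simp: dirichlet_norm_def)
  finally have *: "cmod (f 0) powr p + I \<le> 1" by simp
  then have "I \<le> 1" using powr_ge_zero[of "cmod (f 0)" p] by linarith
  then show "dirichlet_integral \<alpha> p f \<le> 1" using I(2) by simp
  show "cmod (f 0) \<le> 1"
  proof (rule ccontr)
    assume "\<not> cmod (f 0) \<le> 1"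
    then have "1 powr p < cmod (f 0) powr p" using p by (intro powr_less_mono2) auto
    then show False using * I(1) by simp
  qed
qed

section \<open>From bounds on the derivative to bounds on the function\<close>

lemma radial_increment:
  assumes f: "f holomorphic_on unit_disc" and z: "z \<in> unit_disc"
  shows "ennreal (cmod (f z - f 0))
       \<le> (\<integral>\<^sup>+t. ennreal (cmod (deriv f (of_real t * sgn z))) * indicator {0..cmod z} t \<partial>lborel)"
proof (cases "z = 0")
  case False
  define u where "u = sgn z"
  have u: "cmod u = 1" "of_real (cmod z) * u = z"
    using False by (auto simp: u_def norm_sgn) (simp add: sgn_eq)
  have sub: "of_real t * u \<in> unit_disc" if "t \<in> {0..cmod z}" for t
    using that z u by (simp add: norm_mult)
  have "((\<lambda>t. u * deriv f (of_real t * u)) has_integral (f (of_real (cmod z) * u) - f (of_real 0 * u))) {0..cmod z}"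
  proof (rule fundamental_theorem_of_calculus)
    fix t assume t: "t \<in> {0..cmod z}"
    have "((\<lambda>t. of_real t * u) has_vector_derivative u) (at t)"
      by (auto intro!: derivative_eq_intros simp: has_vector_derivative_def scaleR_conv_of_real)
    moreover have "(f has_field_derivative deriv f (of_real t * u)) (at (of_real t * u))"
      using f sub[OF t] by (intro holomorphic_derivI) auto
    ultimately have "((f \<circ> (\<lambda>t. of_real t * u)) has_vector_derivative (u * deriv f (of_real t * u))) (at t)"
      by (rule field_vector_diff_chain_at)
    then show "((\<lambda>t. f (of_real t * u)) has_vector_derivative u * deriv f (of_real t * u)) (at t within {0..cmod z})"
      by (auto simp: o_def intro: has_vector_derivative_at_within)
  qed simp
  moreover have "continuous_on {0..cmod z} (\<lambda>t. u * deriv f (of_real t * u))"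
    by (intro continuous_intros continuous_on_compose2[OF continuous_on_deriv_disc[OF f]]) (use sub in auto)
  ultimately show ?thesis
    using norm_has_integral_le_nn_integral[of 0 "cmod z" "\<lambda>t. u * deriv f (of_real t * u)"]
    by (simp add: norm_mult u flip: u_def)
qed simp

text \<open>With \<open>s = (\<alpha> + 2) / p\<close> the derivative is at most a constant times
  \<open>(1 - |w|)^(-s)\<close>, and the fraction is the integral of \<open>(1 - t)^(-s)\<close>
  from 0 to \<open>|z|\<close>. One formula covers both signs of \<open>s - 1\<close>: for
  \<open>s > 1\<close> it blows up at the boundary, for \<open>s < 1\<close> it stays bounded. At
  \<open>s = 1\<close> the antiderivative would be a logarithm.\<close>

lemma growth_powr:
  assumes p: "0 < p" and ne: "\<alpha> + 2 \<noteq> p"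
  obtains C where "C > 0"
    "\<And>f z. \<lbrakk>f \<in> dirichlet_space \<alpha> p; dirichlet_norm \<alpha> p f \<le> 1; z \<in> unit_disc\<rbrakk> \<Longrightarrow>
      cmod (f z) \<le> 1 + C * (((1 - cmod z) powr (1 - (\<alpha> + 2) / p) - 1) / ((\<alpha> + 2) / p - 1))"
proof -
  obtain C where C: "C > 0" "\<And>f z. \<lbrakk>f holomorphic_on unit_disc; z \<in> unit_disc\<rbrakk> \<Longrightarrow>
       ennreal ((1 - cmod z) powr (\<alpha> + 2) * cmod (deriv f z) powr p) \<le> ennreal C * dirichlet_integral \<alpha> p f"
    by (rule deriv_growth[OF p]) (rule that)
  define s where "s = (\<alpha> + 2) / p"
  have s: "s \<noteq> 1" using p ne by (simp add: s_def)
  show ?thesis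
  proof (rule that[of "C powr (1/p)"])
    fix f and z :: complex
    assume f: "f \<in> dirichlet_space \<alpha> p" "dirichlet_norm \<alpha> p f \<le> 1" and z: "z \<in> unit_disc"
    have hol: "f holomorphic_on unit_disc" using f by (simp add: dirichlet_space_def)
    note le1 = dirichlet_norm_le_1[OF p f]
    have f': "cmod (deriv f w) \<le> C powr (1/p) * (1 - cmod w) powr (- s)" if w: "w \<in> unit_disc" for w
    proof -
      have "ennreal ((1 - cmod w) powr (\<alpha> + 2) * cmod (deriv f w) powr p) \<le> ennreal C * 1"
        using C(2)[OF hol w] mult_left_mono[OF le1(2), of "ennreal C"] by (auto intro: order_trans)
      then have "(1 - cmod w) powr (\<alpha> + 2) * cmod (deriv f w) powr p \<le> C"
        using C(1) by simp
      then have "cmod (deriv f w) powr p \<le> C * (1 - cmod w) powr (- (\<alpha> + 2))"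
        using w by (simp add: powr_minus field_simps del: minus_add_distrib)
      then have "(cmod (deriv f w) powr p) powr (1/p) \<le> (C * (1 - cmod w) powr (- (\<alpha> + 2))) powr (1/p)"
        using p by (intro powr_mono2) auto
      then show ?thesis
        using p C(1) by (simp add: powr_powr powr_mult s_def minus_divide_left)
    qed
    define A where "A = ((1 - cmod z) powr (1 - s) - 1) / (s - 1)"
    have "ennreal (cmod (f z - f 0)) \<le> (\<integral>\<^sup>+t. ennreal (cmod (deriv f (of_real t * sgn z))) * indicator {0..cmod z} t \<partial>lborel)"
      by (rule radial_increment[OF hol z])
    also have "\<dots> \<le> (\<integral>\<^sup>+t. ennreal (C powr (1/p) * (1 - t) powr (- s)) * indicator {0..cmod z} t \<partial>lborel)"
    proof (intro nn_integral_mono)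
      fix t
      show "ennreal (cmod (deriv f (of_real t * sgn z))) * indicator {0..cmod z} t
         \<le> ennreal (C powr (1/p) * (1 - t) powr (- s)) * indicator {0..cmod z} t"
      proof (cases "t \<in> {0..cmod z} \<and> z \<noteq> 0")
        case True
        then have "cmod (of_real t * sgn z) = t" by (simp add: norm_mult norm_sgn)
        then show ?thesis using f'[of "of_real t * sgn z"] True z by (auto intro!: ennreal_leI)
      next
        \<comment> \<open>Either the indicator vanishes, or \<open>z = 0\<close> and hence
          \<open>t = 0\<close>; \<open>sgn z\<close> then has norm 0 instead of 1.\<close>
        case False
        then show ?thesis using f'[of 0] by (auto simp: indicator_def intro!: ennreal_leI)
      qed
    qed
    also have "\<dots> = ennreal (C powr (1/p) * ((1 - cmod z) powr (1 - s) / (s - 1)) - C powr (1/p) * ((1 - 0) powr (1 - s) / (s - 1)))"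
    proof (rule nn_integral_FTC_Icc[where F = "\<lambda>t. C powr (1/p) * ((1 - t) powr (1 - s) / (s - 1))"])
      fix t assume "t \<in> {0..cmod z}"
      then have "t < 1" using z by simp
      then have "((\<lambda>t. (1 - t) powr (1 - s)) has_real_derivative (s - 1) * (1 - t) powr (- s)) (at t)"
        by (auto intro!: derivative_eq_intros simp: algebra_simps)
      from DERIV_cmult[OF DERIV_cdivide[OF this, of "s - 1"], of "C powr (1/p)"]
      show "((\<lambda>t. C powr (1/p) * ((1 - t) powr (1 - s) / (s - 1))) has_real_derivative C powr (1/p) * (1 - t) powr (- s)) (at t)"
        using s by simp
    qed (use z in auto)
    also have "\<dots> = ennreal (C powr (1/p) * A)"
      by (simp add: A_def diff_divide_distrib right_diff_distrib)
    finally have "ennreal (cmod (f z - f 0)) \<le> ennreal (C powr (1/p) * A)" .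
    \<comment> \<open>Needed to return from \<open>ennreal\<close>, which sends negative reals to
      0.\<close>
    moreover have "A \<ge> 0"
    proof (cases "s > 1")
      case True
      then have "1 powr (1 - s) \<le> (1 - cmod z) powr (1 - s)"
        using z by (intro powr_mono2') auto
      then show ?thesis using True by (simp add: A_def)
    next
      case False
      then have "(1 - cmod z) powr (1 - s) \<le> 1 powr (1 - s)"
        using z by (intro powr_mono2) auto
      then show ?thesis using False by (simp add: A_def divide_nonpos_nonpos)
    qed
    ultimately have "cmod (f z - f 0) \<le> C powr (1/p) * A"
      by simp
    then show "cmod (f z) \<le> 1 + C powr (1/p) * (((1 - cmod z) powr (1 - (\<alpha> + 2) / p) - 1) / ((\<alpha> + 2) / p - 1))"
      using le1(1) norm_triangle_sub[of "f z" "f 0"] by (simp add: A_def s_def)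
  qed (use C in simp)
qed

text \<open>Apply the submean inequality at each point of the radius and exchange the integrals. A
  point \<open>w\<close> is then weighted by the integral of \<open>(1 - t)^(p-3)\<close> over those
  \<open>t\<close> whose disc contains \<open>w\<close>. With \<open>x = 1 - |w|^2\<close>, these
  \<open>t\<close> lie in an interval of length \<open>2 x\<close> and have \<open>1 - t\<close>
  comparable to \<open>x\<close>, which yields the weight \<open>x^(p-2)\<close> of the space with
  \<open>\<alpha> = p - 2\<close>.\<close>

lemma radial_carleson:
  assumes p: "0 < p"
  obtains C :: real where "C > 0"
    "\<And>f u r. \<lbrakk>f holomorphic_on unit_disc; cmod u = 1; 0 \<le> r; r < 1\<rbrakk> \<Longrightarrow>
       (\<integral>\<^sup>+t. ennreal ((1 - t) powr (p - 1) * cmod (deriv f (of_real t * u)) powr p) * indicator {0..r} t \<partial>lborel)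
       \<le> ennreal C * dirichlet_integral (p - 2) p f"
proof -
  obtain C where C: "C > 0" "\<And>f z. \<lbrakk>f holomorphic_on unit_disc; z \<in> unit_disc\<rbrakk> \<Longrightarrow>
       ennreal ((1 - cmod z)\<^sup>2 * cmod (deriv f z) powr p)
       \<le> ennreal C * (\<integral>\<^sup>+w. ennreal (cmod (deriv f w) powr p) * indicator (ball z ((1 - cmod z) / 2)) w \<partial>lborel)"
    by (rule deriv_submean[OF p]) (rule that)
  define K where "K = 2 * 3 powr \<bar>p - 3\<bar>"
  show ?thesis
  proof (rule that[of "C * K * pi"])
    fix f and u :: complex and r :: real
    assume f: "f holomorphic_on unit_disc" and u: "cmod u = 1" and r: "0 \<le> r" "r < 1"
    define G where "G w = ennreal (cmod (deriv f w) powr p) * indicator unit_disc w" for w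
    have [measurable]: "G \<in> borel_measurable borel"
      unfolding G_def
      by (intro borel_measurable_cmod_powr_on_open[OF continuous_on_deriv_disc[OF f]]) auto
    \<comment> \<open>The exponent \<open>p - 3\<close> is \<open>p - 1\<close> less the two powers
      spent on the submean inequality.\<close>
    define H where "H t w = ennreal ((1 - t) powr (p - 3)) * (if dist (of_real t * u) w < (1 - t) / 2 then 1 else 0) * indicator {0..r} t" for t w
    have [measurable]: "(\<lambda>(t, w). H t w) \<in> borel_measurable (borel \<Otimes>\<^sub>M borel)"
      unfolding H_def by measurable
    have norm_tu: "cmod (of_real t * u) = t" if "t \<in> {0..r}" for t
      using that u by (simp add: norm_mult)
    have "(\<integral>\<^sup>+t. ennreal ((1 - t) powr (p - 1) * cmod (deriv f (of_real t * u)) powr p) * indicator {0..r} t \<partial>lborel)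
        \<le> (\<integral>\<^sup>+t. ennreal C * (\<integral>\<^sup>+w. H t w * G w \<partial>lborel) \<partial>lborel)"
    proof (intro nn_integral_mono)
      fix t :: real
      show "ennreal ((1 - t) powr (p - 1) * cmod (deriv f (of_real t * u)) powr p) * indicator {0..r} t
         \<le> ennreal C * (\<integral>\<^sup>+w. H t w * G w \<partial>lborel)"
      proof (cases "t \<in> {0..r}")
        case True
        define z where "z = of_real t * u"
        have z: "cmod z = t" "z \<in> unit_disc" using norm_tu[OF True] True r by (auto simp: z_def)
        have t: "t < 1" using True r by simp
        have "(1 - t) powr (p - 1) = (1 - t) powr (p - 3) * (1 - t)\<^sup>2"
          using t by (simp flip: powr_add powr_numeral)
        then have "ennreal ((1 - t) powr (p - 1) * cmod (deriv f z) powr p)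
            = ennreal ((1 - t) powr (p - 3)) * ennreal ((1 - cmod z)\<^sup>2 * cmod (deriv f z) powr p)"
          by (simp add: z mult.assoc flip: ennreal_mult)
        also have "\<dots> \<le> ennreal ((1 - t) powr (p - 3)) *
           (ennreal C * (\<integral>\<^sup>+w. ennreal (cmod (deriv f w) powr p) * indicator (ball z ((1 - cmod z) / 2)) w \<partial>lborel))"
          by (intro mult_left_mono C(2) f z) auto
        also have "(\<integral>\<^sup>+w. ennreal (cmod (deriv f w) powr p) * indicator (ball z ((1 - cmod z) / 2)) w \<partial>lborel)
           = (\<integral>\<^sup>+w. (if dist z w < (1 - t) / 2 then 1 else 0) * G w \<partial>lborel)"
          using defect_comparable(1)[OF z(2)] z(1)
          by (intro nn_integral_cong) (auto simp: G_def indicator_def)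
        also have "ennreal ((1 - t) powr (p - 3)) * (ennreal C * \<dots>)
           = ennreal C * (ennreal ((1 - t) powr (p - 3)) * (\<integral>\<^sup>+w. (if dist z w < (1 - t) / 2 then 1 else 0) * G w \<partial>lborel))"
          by (simp add: mult_ac)
        also have "ennreal ((1 - t) powr (p - 3)) * (\<integral>\<^sup>+w. (if dist z w < (1 - t) / 2 then 1 else 0) * G w \<partial>lborel)
           = (\<integral>\<^sup>+w. H t w * G w \<partial>lborel)"
          using True by (subst nn_integral_cmult[symmetric]) (auto simp: H_def mult.assoc z_def)
        finally show ?thesis using True by (simp add: z_def)
      qed simp
    qed
    also have "\<dots> = ennreal C * (\<integral>\<^sup>+t. (\<integral>\<^sup>+w. H t w * G w \<partial>lborel) \<partial>lborel)"
      by (rule nn_integral_cmult) measurable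
    also have "(\<integral>\<^sup>+t. (\<integral>\<^sup>+w. H t w * G w \<partial>lborel) \<partial>lborel) = (\<integral>\<^sup>+w. (\<integral>\<^sup>+t. H t w * G w \<partial>lborel) \<partial>lborel)"
      by (rule lborel_pair.Fubini'[symmetric]) measurable
    also have "\<dots> \<le> (\<integral>\<^sup>+w. ennreal K * (ennreal ((1 - (cmod w)\<^sup>2) powr (p - 2) * cmod (deriv f w) powr p) * indicator unit_disc w) \<partial>lborel)"
    proof (intro nn_integral_mono)
      fix w :: complex
      show "(\<integral>\<^sup>+t. H t w * G w \<partial>lborel)
        \<le> ennreal K * (ennreal ((1 - (cmod w)\<^sup>2) powr (p - 2) * cmod (deriv f w) powr p) * indicator unit_disc w)"
      proof (cases "w \<in> unit_disc")
        case True
        define x where "x = 1 - (cmod w)\<^sup>2"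
        have x: "x > 0" using cmod_square_less_1[OF True] by (simp add: x_def)
        \<comment> \<open>The interval encodes \<open>1 - t \<le> 2 * x\<close>, the fourth part of
          \<open>defect_comparable\<close>. Its length \<open>2 * x\<close> supplies the missing
          power of \<open>x\<close> and the 2 in \<open>K\<close>.\<close>
        have "(\<integral>\<^sup>+t. H t w \<partial>lborel) \<le> (\<integral>\<^sup>+t. ennreal (3 powr \<bar>p - 3\<bar> * x powr (p - 3)) * indicator {1 - 2 * x..1} t \<partial>lborel)"
        proof (intro nn_integral_mono)
          fix t :: real
          show "H t w \<le> ennreal (3 powr \<bar>p - 3\<bar> * x powr (p - 3)) * indicator {1 - 2 * x..1} t"
          proof (cases "t \<in> {0..r} \<and> dist (of_real t * u) w < (1 - t) / 2")
            case True
            then have t: "cmod (of_real t * u) = t" "of_real t * u \<in> unit_disc" "t < 1"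
              using norm_tu[of t] r by auto
            note d = defect_comparable[OF t(2), of w, unfolded t(1)]
            have "(1 - t) powr (p - 3) \<le> 3 powr \<bar>p - 3\<bar> * x powr (p - 3)"
              using d True t x unfolding x_def by (intro powr_comparable) auto
            then show ?thesis using True d(4) t by (auto simp: H_def x_def intro!: ennreal_leI)
          qed (auto simp: H_def)
        qed
        also have "\<dots> = ennreal (3 powr \<bar>p - 3\<bar> * x powr (p - 3) * (2 * x))"
          using x by (subst nn_integral_cmult_indicator) (auto simp: ennreal_mult)
        also have "3 powr \<bar>p - 3\<bar> * x powr (p - 3) * (2 * x) = K * x powr (p - 2)"
        proof -
          have "x powr (p - 2) = x powr (p - 3) * x powr 1"
            unfolding powr_add[symmetric] by simp
          then show ?thesis using x by (simp add: K_def)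
        qed
        finally have "(\<integral>\<^sup>+t. H t w \<partial>lborel) * G w \<le> ennreal (K * x powr (p - 2)) * G w"
          by (rule mult_right_mono) simp
        then show ?thesis
          using True by (simp add: nn_integral_multc G_def x_def K_def ennreal_mult mult.assoc)
      qed (simp add: G_def)
    qed
    also have "\<dots> = ennreal K * (\<integral>\<^sup>+w. ennreal ((1 - (cmod w)\<^sup>2) powr (p - 2) * cmod (deriv f w) powr p) * indicator unit_disc w \<partial>lborel)"
    proof (rule nn_integral_cmult)
      have "(\<lambda>w. ennreal ((1 - (cmod w)\<^sup>2) powr (p - 2)) * G w) \<in> borel_measurable lborel"
        by measurable
      then show "(\<lambda>w. ennreal ((1 - (cmod w)\<^sup>2) powr (p - 2) * cmod (deriv f w) powr p) * indicator unit_disc w) \<in> borel_measurable lborel"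
        by (simp add: G_def ennreal_mult mult.assoc)
    qed
    also have "(\<integral>\<^sup>+w. ennreal ((1 - (cmod w)\<^sup>2) powr (p - 2) * cmod (deriv f w) powr p) * indicator unit_disc w \<partial>lborel)
       = ennreal pi * dirichlet_integral (p - 2) p f"
    proof -
      have "ennreal pi * ennreal (1 / pi) = 1" by (simp flip: ennreal_mult)
      then show ?thesis by (simp add: dirichlet_integral_lborel[OF f] flip: mult.assoc)
    qed
    finally show "(\<integral>\<^sup>+t. ennreal ((1 - t) powr (p - 1) * cmod (deriv f (of_real t * u)) powr p) * indicator {0..r} t \<partial>lborel)
       \<le> ennreal (C * K * pi) * dirichlet_integral (p - 2) p f"
      using C(1) by (simp add: mult_left_mono ennreal_mult K_def mult.assoc)
  qed (use C in \<open>simp add: K_def\<close>)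
qed

text \<open>The Carleson-type estimate bounds the integral of \<open>(1 - t)^(p-1) |f'|^p\<close>
  along the radius. Interpolating \<open>|f'|\<close> at a multiple of \<open>1 / (1 - t)\<close>
  leaves this integral and that of \<open>1 / (1 - t)\<close>, which is at most
  \<open>L\<close>.\<close>

lemma growth_log:
  assumes p: "1 < p"
  obtains C where "C > 0"
    "\<And>f z. \<lbrakk>f \<in> dirichlet_space (p - 2) p; dirichlet_norm (p - 2) p f \<le> 1; z \<in> unit_disc\<rbrakk> \<Longrightarrow>
      cmod (f z) \<le> 1 + C * ln (2 / (1 - (cmod z)\<^sup>2)) powr (1 - 1 / p)"
proof -
  obtain C where C: "C > 0"
    "\<And>f u r. \<lbrakk>f holomorphic_on unit_disc; cmod u = 1; 0 \<le> r; r < 1\<rbrakk> \<Longrightarrow>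
       (\<integral>\<^sup>+t. ennreal ((1 - t) powr (p - 1) * cmod (deriv f (of_real t * u)) powr p) * indicator {0..r} t \<partial>lborel)
       \<le> ennreal C * dirichlet_integral (p - 2) p f"
    using p by (rule radial_carleson[of p, OF order.strict_trans[OF zero_less_one]]) (rule that)
  show ?thesis
  \<comment> \<open>The 1 comes from the integral of \<open>1 / (1 - t)\<close>, the
    \<open>C\<close> from the Carleson-type estimate.\<close>
  proof (rule that[of "C + 1"])
    fix f and z :: complex
    assume f: "f \<in> dirichlet_space (p - 2) p" "dirichlet_norm (p - 2) p f \<le> 1" and z: "z \<in> unit_disc"
    have hol: "f holomorphic_on unit_disc" using f by (simp add: dirichlet_space_def)
    have le1: "cmod (f 0) \<le> 1" "dirichlet_integral (p - 2) p f \<le> 1"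
      using dirichlet_norm_le_1[OF _ f] p by auto
    define L where "L = ln (2 / (1 - (cmod z)\<^sup>2))"
    have sq: "(cmod z)\<^sup>2 < 1" by (rule cmod_square_less_1[OF z])
    \<comment> \<open>The 2 in the logarithm keeps \<open>L\<close> away from 0 at the origin and,
      just below, absorbs the factor in \<open>1 - |z|^2 \<le> 2 (1 - |z|)\<close>.\<close>
    have "ln 2 \<le> L" unfolding L_def using sq by (subst ln_le_cancel_iff) (auto simp: field_simps)
    then have L: "L > 0" using ln_gt_zero[of 2] by linarith
    have L_ge: "- ln (1 - cmod z) \<le> L"
    proof -
      have "(1 - cmod z) * (1 + cmod z) \<le> (1 - cmod z) * 2"
        using z by (intro mult_left_mono) auto
      then have "1 - (cmod z)\<^sup>2 \<le> 2 * (1 - cmod z)" by (simp add: power2_eq_square algebra_simps)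
      then have "ln (1 / (1 - cmod z)) \<le> L"
        unfolding L_def using sq z by (subst ln_le_cancel_iff) (auto simp: field_simps)
      then show ?thesis using z by (simp add: ln_div)
    qed
    have "cmod (f z - f 0) \<le> (C + 1) * L powr (1 - 1/p)"
    proof (cases "z = 0")
      case False
      define u where "u = sgn z"
      have u: "cmod u = 1" using False by (simp add: u_def norm_sgn)
      let ?F = "\<lambda>t. cmod (deriv f (of_real t * u))"
      let ?J = "\<integral>\<^sup>+t. ennreal ((1 - t) powr (p - 1) * ?F t powr p) * indicator {0..cmod z} t \<partial>lborel"
      have cont: "continuous_on {0..cmod z} ?F"
        by (intro continuous_intros continuous_on_compose2[OF continuous_on_deriv_disc[OF hol]])
           (use z u in \<open>auto simp: norm_mult\<close>)
      then have "(\<lambda>t. indicator {0..cmod z} t *\<^sub>R ?F t) \<in> borel_measurable borel"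
        by (intro borel_measurable_continuous_on_indicator) auto
      then have "(\<lambda>t. ennreal ((1 - t) powr (p - 1) * (indicator {0..cmod z} t *\<^sub>R ?F t) powr p) * indicator {0..cmod z} t) \<in> borel_measurable borel"
        by measurable
      also have "(\<lambda>t. ennreal ((1 - t) powr (p - 1) * (indicator {0..cmod z} t *\<^sub>R ?F t) powr p) * indicator {0..cmod z} t)
         = (\<lambda>t. ennreal ((1 - t) powr (p - 1) * ?F t powr p) * indicator {0..cmod z} t)"
        by (auto simp: indicator_def)
      finally have [measurable]: "(\<lambda>t. ennreal ((1 - t) powr (p - 1) * ?F t powr p) * indicator {0..cmod z} t) \<in> borel_measurable borel" .
      have "ennreal (cmod (f z - f 0)) \<le> (\<integral>\<^sup>+t. ennreal (?F t) * indicator {0..cmod z} t \<partial>lborel)"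
        unfolding u_def by (rule radial_increment[OF hol z])
      also have "\<dots> \<le> (\<integral>\<^sup>+t. ennreal (L powr (- 1 / p)) * (ennreal (1 / (1 - t)) * indicator {0..cmod z} t)
          + ennreal (L powr (1 - 1 / p)) * (ennreal ((1 - t) powr (p - 1) * ?F t powr p) * indicator {0..cmod z} t) \<partial>lborel)"
      proof (intro nn_integral_mono)
        fix t
        show "ennreal (?F t) * indicator {0..cmod z} t \<le> ennreal (L powr (- 1 / p)) * (ennreal (1 / (1 - t)) * indicator {0..cmod z} t)
          + ennreal (L powr (1 - 1 / p)) * (ennreal ((1 - t) powr (p - 1) * ?F t powr p) * indicator {0..cmod z} t)"
        proof (cases "t \<in> {0..cmod z}")
          case True
          then have t: "t < 1" using z by simp
          \<comment> \<open>With this \<open>c\<close> both terms below integrate to a multiple of \<open>L\<^bsup>1-1/p\<^esup>\<close>; this replaces Hoelder.\<close>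
          define c where "c = L powr (- 1 / p) / (1 - t)"
          have c: "c > 0" using t L by (simp add: c_def)
          have "?F t \<le> c + c powr (1 - p) * ?F t powr p"
            using p c by (intro le_add_powr_interpolation) auto
          also have "c powr (1 - p) = L powr (1 - 1 / p) * (1 - t) powr (p - 1)"
          proof -
            have "c powr (1 - p) = L powr (- 1 / p * (1 - p)) / (1 - t) powr (1 - p)"
              using t L by (simp add: c_def powr_divide powr_powr)
            also have "- 1 / p * (1 - p) = 1 - 1 / p" using p by (simp add: field_simps)
            also have "(1 - t) powr (1 - p) = 1 / (1 - t) powr (p - 1)"
              using t by (simp add: powr_diff)
            finally show ?thesis by simp
          qed
          finally have "ennreal (?F t) \<le> ennreal (L powr (- 1 / p) * (1 / (1 - t)) + L powr (1 - 1 / p) * ((1 - t) powr (p - 1) * ?F t powr p))"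
            by (intro ennreal_leI) (simp add: c_def)
          also have "\<dots> = ennreal (L powr (- 1 / p)) * ennreal (1 / (1 - t))
             + ennreal (L powr (1 - 1 / p)) * ennreal ((1 - t) powr (p - 1) * ?F t powr p)"
            using t by (subst ennreal_plus) (simp_all add: ennreal_mult[symmetric])
          finally show ?thesis using True by simp
        qed simp
      qed
      also have "\<dots> = ennreal (L powr (- 1 / p)) * (\<integral>\<^sup>+t. ennreal (1 / (1 - t)) * indicator {0..cmod z} t \<partial>lborel) + ennreal (L powr (1 - 1 / p)) * ?J"
        by (subst nn_integral_add, measurable) (subst nn_integral_cmult, measurable)+
      also have "(\<integral>\<^sup>+t. ennreal (1 / (1 - t)) * indicator {0..cmod z} t \<partial>lborel) = ennreal (- ln (1 - cmod z) - - ln (1 - 0))"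
        by (rule nn_integral_FTC_Icc[where F = "\<lambda>t. - ln (1 - t)"])
           (use z in \<open>auto intro!: derivative_eq_intros simp: field_simps\<close>)
      also have "ennreal (L powr (- 1 / p)) * \<dots> + ennreal (L powr (1 - 1 / p)) * ?J
         \<le> ennreal (L powr (- 1 / p)) * ennreal L + ennreal (L powr (1 - 1 / p)) * ennreal C"
      proof (intro add_mono mult_left_mono)
        have "?J \<le> ennreal C * dirichlet_integral (p - 2) p f"
          using z by (intro C(2)[OF hol u]) auto
        also have "\<dots> \<le> ennreal C" using mult_left_mono[OF le1(2), of "ennreal C"] by simp
        finally show "?J \<le> ennreal C" .
      qed (use L_ge in \<open>auto intro!: ennreal_leI\<close>)
      also have "\<dots> = ennreal ((C + 1) * L powr (1 - 1/p))"
      proof -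
        have "L powr (- 1 / p) * L = L powr (- 1 / p) * L powr 1" using L by simp
        also have "\<dots> = L powr (1 - 1/p)" unfolding powr_add[symmetric] by simp
        finally show ?thesis using C(1) L by (simp add: algebra_simps flip: ennreal_mult ennreal_plus)
      qed
      finally show ?thesis using C(1) by simp
    qed (use C L in simp)
    then show "cmod (f z) \<le> 1 + (C + 1) * ln (2 / (1 - (cmod z)\<^sup>2)) powr (1 - 1 / p)"
      using le1(1) norm_triangle_sub[of "f z" "f 0"] by (simp add: L_def)
  qed (use C in simp)
qed

section \<open>Integrals of the kernel\<close>

text \<open>The disc of radius \<open>sqrt c\<close> has area \<open>pi * c\<close>, linear in
  \<open>c\<close>. Hence \<open>|z|^2\<close>, unlike \<open>|z|\<close>, has constant density, and
  the half-lines \<open>{..<c}\<close> generate the Borel sets.\<close>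

lemma distr_cmod_square:
  "distr lborel borel (\<lambda>z::complex. (cmod z)\<^sup>2) = density lborel (\<lambda>t. ennreal pi * indicator {0..} t)"
  (is "?M = ?N")
proof (rule measure_eqI_generator_eq[where \<Omega> = UNIV and E = "range lessThan" and A = "\<lambda>i. {..<real i}"])
  show "Int_stable (range lessThan :: real set set)"
  proof (rule Int_stableI_image)
    show "\<exists>c\<in>UNIV. {..<a} \<inter> {..<b} = {..<c}" for a b :: real
      by (intro bexI[of _ "min a b"]) auto
  qed
  have ball: "(\<lambda>z::complex. (cmod z)\<^sup>2) -` {..<c} = ball 0 (sqrt c)" for c
  proof -
    have "cmod z < sqrt c \<longleftrightarrow> (cmod z)\<^sup>2 < c" for z
      using real_sqrt_less_iff[of "(cmod z)\<^sup>2" c] by simp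
    then show ?thesis by auto
  qed
  have M: "emeasure ?M {..<c} = ennreal (pi * max 0 c)" for c
    by (cases "c \<ge> 0") (simp_all add: emeasure_distr ball emeasure_ball unit_ball_vol_2 ball_empty)
  have N: "emeasure ?N {..<c} = ennreal (pi * max 0 c)" for c
  proof -
    have "emeasure ?N {..<c} = (\<integral>\<^sup>+t. ennreal pi * indicator ({0..} \<inter> {..<c}) t \<partial>lborel)"
      by (subst emeasure_density) (auto simp: indicator_def intro!: nn_integral_cong)
    also have "\<dots> = ennreal pi * emeasure lborel ({0..} \<inter> {..<c})"
      by (rule nn_integral_cmult_indicator) auto
    also have "{0..} \<inter> {..<c} = {0..<c}" by auto
    finally show ?thesis by (cases "c \<ge> 0") (auto simp: ennreal_mult)
  qed
  show "emeasure ?M X = emeasure ?N X" if "X \<in> range lessThan" for X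
    using that M N by auto
  show "emeasure ?M ({..<real i}) \<noteq> \<infinity>" for i
    by (simp add: M)
qed (auto simp: borel_Iio reals_Archimedean2)

lemma nn_integral_radial:
  assumes [measurable]: "\<psi> \<in> borel_measurable borel"
  shows "(\<integral>\<^sup>+z. \<psi> ((cmod z)\<^sup>2) \<partial>(lborel :: complex measure)) = ennreal pi * (\<integral>\<^sup>+t. \<psi> t * indicator {0..} t \<partial>lborel)"
proof -
  have "(\<integral>\<^sup>+z. \<psi> ((cmod z)\<^sup>2) \<partial>(lborel :: complex measure)) = (\<integral>\<^sup>+t. \<psi> t \<partial>distr lborel borel (\<lambda>z::complex. (cmod z)\<^sup>2))"
    by (subst nn_integral_distr) auto
  also have "\<dots> = (\<integral>\<^sup>+t. ennreal pi * (\<psi> t * indicator {0..} t) \<partial>lborel)"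
    unfolding distr_cmod_square by (subst nn_integral_density) (auto simp: mult_ac)
  also have "\<dots> = ennreal pi * (\<integral>\<^sup>+t. \<psi> t * indicator {0..} t \<partial>lborel)"
    by (rule nn_integral_cmult) measurable
  finally show ?thesis .
qed

text \<open>For \<open>|t| \<le> pi / 2\<close> the distance from 1 to the line through 0 and
  \<open>cis t\<close> is \<open>|sin t|\<close>, and concavity of the sine gives Jordan's
  inequality, used here up to a factor 2. For larger \<open>|t|\<close> the real part is already at
  least 1. The bound is uniform in \<open>\<rho>\<close>.\<close>

lemma cmod_one_minus_rcis_ge:
  assumes \<rho>: "0 \<le> \<rho>" and t: "\<bar>t\<bar> \<le> pi"
  shows "cmod (1 - of_real \<rho> * cis t) \<ge> \<bar>t\<bar> / pi"
proof -
  have sq: "(cmod (1 - of_real \<rho> * cis t))\<^sup>2 = (\<rho> - cos t)\<^sup>2 + (sin t)\<^sup>2"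
  proof -
    have "(cmod (1 - of_real \<rho> * cis t))\<^sup>2 = (1 - \<rho> * cos t)\<^sup>2 + (\<rho> * sin t)\<^sup>2"
      by (simp add: cmod_power2)
    also have "\<dots> = 1 - 2 * \<rho> * cos t + \<rho>\<^sup>2 * ((cos t)\<^sup>2 + (sin t)\<^sup>2)"
      by (simp add: power2_diff power_mult_distrib distrib_left del: sin_cos_squared_add sin_cos_squared_add2)
    also have "\<dots> = (\<rho> - cos t)\<^sup>2 + (sin t)\<^sup>2"
      by (simp add: power2_diff sin_squared_eq)
    finally show ?thesis .
  qed
  show ?thesis
  proof (cases "\<bar>t\<bar> \<le> pi / 2")
    case True
    have "concave_on {0..pi} sin"
      unfolding concave_on_def
      by (rule f''_ge0_imp_convex[where f' = "\<lambda>x. - cos x" and f'' = sin])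
         (auto intro!: derivative_eq_intros simp: sin_ge_zero)
    then have "sin ((1 - 2 * \<bar>t\<bar> / pi) *\<^sub>R 0 + (2 * \<bar>t\<bar> / pi) *\<^sub>R (pi / 2)) \<ge> (1 - 2 * \<bar>t\<bar> / pi) * sin 0 + (2 * \<bar>t\<bar> / pi) * sin (pi / 2)"
      by (rule concave_onD) (use True in \<open>auto simp: field_simps\<close>)
    then have "\<bar>t\<bar> / pi \<le> sin \<bar>t\<bar>" by (simp add: field_simps)
    also have "\<dots> \<le> \<bar>sin t\<bar>" by (cases "t \<ge> 0") auto
    also have "\<bar>sin t\<bar> \<le> cmod (1 - of_real \<rho> * cis t)"
      using sq by (intro abs_le_square_iff[THEN iffD2, of "sin t" "cmod (1 - of_real \<rho> * cis t)", simplified]) simp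
    finally show ?thesis .
  next
    case False
    have "cos \<bar>t\<bar> \<le> 0"
      using cos_monotone_0_pi_le[of "pi / 2" "\<bar>t\<bar>"] False t by simp
    then have "cos t \<le> 0" by simp
    then have "1 \<le> 1 - \<rho> * cos t" using \<rho> by (simp add: mult_nonneg_nonpos)
    also have "\<dots> = Re (1 - of_real \<rho> * cis t)" by simp
    also have "\<dots> \<le> cmod (1 - of_real \<rho> * cis t)" by (rule complex_Re_le_cmod)
    finally show ?thesis using t by (auto intro: order_trans[of _ 1])
  qed
qed

text \<open>On a half-line the flat part contributes \<open>d^(1-c)\<close> and the tail
  \<open>d^(1-c) / (c - 1)\<close>, together \<open>c / (c - 1) * d^(1-c)\<close>; the 2 counts the
  two half-lines.\<close>

lemma nn_integral_truncated_powr: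
  assumes c: "c > 1" and d: "d > 0"
  shows "(\<integral>\<^sup>+y. ennreal (max d \<bar>y\<bar> powr (- c)) \<partial>lborel) \<le> ennreal (2 * (c / (c - 1)) * d powr (1 - c))"
proof -
  define M where "M y = ennreal (d powr (- c)) * indicator {0..d} y + ennreal (y powr (- c)) * indicator {d..} y" for y
  have [measurable]: "M \<in> borel_measurable borel" unfolding M_def by measurable
  have "(\<integral>\<^sup>+y. M y \<partial>lborel) = ennreal (d powr (- c)) * ennreal d + ennreal (- (d powr (- c + 1)) / (- c + 1))"
  proof -
    have "(\<integral>\<^sup>+y. ennreal (y powr (- c)) * indicator {d..} y \<partial>lborel) = ennreal (- (d powr (- c + 1)) / (- c + 1))"
      using c d by (intro nn_integral_has_integral_lebesgue' has_integral_powr_to_inf) auto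
    then show ?thesis
      unfolding M_def using d by (subst nn_integral_add) (auto simp: nn_integral_cmult_indicator)
  qed
  also have "\<dots> = ennreal (c / (c - 1) * d powr (1 - c))"
  proof -
    have "d powr (- c) * d = d powr (1 - c)" using d by (simp add: powr_diff powr_minus field_simps)
    moreover have "- (d powr (- c + 1)) / (- c + 1) = d powr (1 - c) / (c - 1)"
    proof -
      have "- c + 1 = - (c - 1)" "1 - c = - (c - 1)" by auto
      then show ?thesis by (simp only: minus_divide_divide)
    qed
    ultimately show ?thesis
      using c d by (simp add: field_simps flip: ennreal_mult ennreal_plus)
  qed
  finally have M: "(\<integral>\<^sup>+y. M y \<partial>lborel) = ennreal (c / (c - 1) * d powr (1 - c))" .
  have "(\<integral>\<^sup>+y. ennreal (max d \<bar>y\<bar> powr (- c)) \<partial>lborel) \<le> (\<integral>\<^sup>+y. M y + M (- y) \<partial>lborel)"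
    using d by (intro nn_integral_mono) (auto simp: M_def max_def indicator_def split: abs_split)
  also have "\<dots> = (\<integral>\<^sup>+y. M y \<partial>lborel) + (\<integral>\<^sup>+y. M (- y) \<partial>lborel)"
    by (rule nn_integral_add) measurable
  also have "(\<integral>\<^sup>+y. M (- y) \<partial>lborel) = (\<integral>\<^sup>+y. M y \<partial>lborel)"
    using nn_integral_real_affine[of M "-1" 0] by simp
  finally show ?thesis
    using c d by (simp add: M mult.assoc flip: ennreal_plus)
qed

text \<open>Both \<open>1 - \<rho>\<close> and \<open>|y| / pi\<close> are lower bounds for
  \<open>|1 - \<rho> cis y|\<close>, so the integrand is majorized by a truncated power with cut-off
  \<open>pi * (1 - \<rho>)\<close>. The phase \<open>s\<close> will be the argument of
  \<open>cnj a * w\<close>.\<close>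

lemma angular_kernel_bound:
  assumes c: "c > 1" and \<rho>: "0 \<le> \<rho>" "\<rho> < 1" and s: "\<bar>s\<bar> \<le> pi"
  shows "(\<integral>\<^sup>+t. ennreal (cmod (1 - of_real \<rho> * cis (t + s)) powr (- c)) * indicator {-pi..pi} t \<partial>lborel)
     \<le> ennreal (6 * pi * (c / (c - 1)) * (1 - \<rho>) powr (1 - c))"
proof -
  define M where "M y = ennreal (max (pi * (1 - \<rho>)) \<bar>y\<bar> powr (- c))" for y :: real
  have [measurable]: "M \<in> borel_measurable borel" unfolding M_def by measurable
  have d: "pi * (1 - \<rho>) > 0" using \<rho> by simp
  have le: "ennreal (cmod (1 - of_real \<rho> * cis y) powr (- c)) \<le> ennreal (pi powr c) * M y" if "\<bar>y\<bar> \<le> pi" for y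
  proof -
    let ?n = "cmod (1 - of_real \<rho> * cis y)"
    have "1 - \<rho> \<le> ?n"
      using norm_triangle_ineq2[of 1 "of_real \<rho> * cis y"] \<rho> by (simp add: norm_mult)
    moreover have "\<bar>y\<bar> \<le> pi * ?n"
      using cmod_one_minus_rcis_ge[OF \<rho>(1) that] by (simp add: field_simps)
    ultimately have "max (pi * (1 - \<rho>)) \<bar>y\<bar> \<le> pi * ?n" by simp
    then have "(pi * ?n) powr (- c) \<le> max (pi * (1 - \<rho>)) \<bar>y\<bar> powr (- c)"
      using c d by (intro powr_mono2') auto
    then have "pi powr c * (pi * ?n) powr (- c) \<le> pi powr c * max (pi * (1 - \<rho>)) \<bar>y\<bar> powr (- c)"
      by (rule mult_left_mono) simp
    also have "pi powr c * (pi * ?n) powr (- c) = ?n powr (- c)"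
      by (simp add: powr_mult powr_minus)
    finally show ?thesis by (simp add: M_def flip: ennreal_mult)
  qed
  have shift: "(\<integral>\<^sup>+t. M (t + r) \<partial>lborel) = (\<integral>\<^sup>+t. M t \<partial>lborel)" for r
    using nn_integral_real_affine[of M 1 r] by (simp add: add.commute)
  \<comment> \<open>The angle \<open>t + s\<close> may leave \<open>[-pi, pi]\<close>, but one shift
    by \<open>2 * pi\<close> brings it back. Adding all three translates of the majorant avoids a
    case split of the integral and turns the constant 2 into 6.\<close>
  have "(\<integral>\<^sup>+t. ennreal (cmod (1 - of_real \<rho> * cis (t + s)) powr (- c)) * indicator {-pi..pi} t \<partial>lborel)
     \<le> (\<integral>\<^sup>+t. ennreal (pi powr c) * (M (t + s) + M (t + (s - 2 * pi)) + M (t + (s + 2 * pi))) \<partial>lborel)"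
  proof (intro nn_integral_mono)
    fix t
    show "ennreal (cmod (1 - of_real \<rho> * cis (t + s)) powr (- c)) * indicator {-pi..pi} t
      \<le> ennreal (pi powr c) * (M (t + s) + M (t + (s - 2 * pi)) + M (t + (s + 2 * pi)))"
    proof (cases "t \<in> {-pi..pi}")
      case True
      then consider "\<bar>t + s\<bar> \<le> pi" | "\<bar>t + (s - 2 * pi)\<bar> \<le> pi" | "\<bar>t + (s + 2 * pi)\<bar> \<le> pi"
        using s by (auto simp: abs_le_iff) linarith
      then have "ennreal (cmod (1 - of_real \<rho> * cis (t + s)) powr (- c))
        \<le> ennreal (pi powr c) * M (t + s) + ennreal (pi powr c) * M (t + (s - 2 * pi)) + ennreal (pi powr c) * M (t + (s + 2 * pi))"
      proof cases
        case 1
        from le[OF 1] show ?thesis by (simp add: add_increasing2)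
      next
        case 2
        have "cis (t + (s - 2 * pi)) = cis (t + s)" by (simp add: complex_eq_iff algebra_simps cos_diff sin_diff cos_add sin_add)
        with le[OF 2] show ?thesis by (simp add: add_increasing add_increasing2)
      next
        case 3
        have "cis (t + (s + 2 * pi)) = cis (t + s)" by (simp add: complex_eq_iff flip: add.assoc)
        with le[OF 3] show ?thesis by (simp add: add_increasing)
      qed
      then show ?thesis using True by (simp add: distrib_left)
    qed simp
  qed
  also have "\<dots> = ennreal (pi powr c) * ((\<integral>\<^sup>+t. M (t + s) \<partial>lborel) + (\<integral>\<^sup>+t. M (t + (s - 2 * pi)) \<partial>lborel) + (\<integral>\<^sup>+t. M (t + (s + 2 * pi)) \<partial>lborel))"
    by (simp add: nn_integral_cmult nn_integral_add)
  also have "\<dots> = ennreal (pi powr c) * ((\<integral>\<^sup>+t. M t \<partial>lborel) + (\<integral>\<^sup>+t. M t \<partial>lborel) + (\<integral>\<^sup>+t. M t \<partial>lborel))"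
    by (simp only: shift)
  also have "\<dots> \<le> ennreal (pi powr c) * (ennreal (2 * (c / (c - 1)) * (pi * (1 - \<rho>)) powr (1 - c))
      + ennreal (2 * (c / (c - 1)) * (pi * (1 - \<rho>)) powr (1 - c)) + ennreal (2 * (c / (c - 1)) * (pi * (1 - \<rho>)) powr (1 - c)))"
    unfolding M_def by (intro mult_left_mono add_mono nn_integral_truncated_powr c d) auto
  also have "\<dots> = ennreal (pi powr c * (6 * (c / (c - 1)) * (pi * (1 - \<rho>)) powr (1 - c)))"
    using c by (simp flip: ennreal_mult ennreal_plus)
  also have "pi powr c * (6 * (c / (c - 1)) * (pi * (1 - \<rho>)) powr (1 - c)) = 6 * pi * (c / (c - 1)) * (1 - \<rho>) powr (1 - c)"
  proof -
    have "pi powr c * pi powr (1 - c) = pi" by (simp flip: powr_add)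
    then show ?thesis using \<rho> by (simp add: powr_mult mult_ac)
  qed
  finally show ?thesis .
qed

text \<open>Rotating \<open>w\<close> leaves the weight unchanged and averages the kernel to at most
  a constant times \<open>(1 - |a| |w|)^(1-c)\<close>. What remains depends on \<open>|w|^2\<close>
  only, so the area integral becomes one over \<open>x = 1 - |w|^2\<close>.\<close>

lemma kernel_integral_bound:
  assumes c: "c > 1" and a: "a \<in> unit_disc"
  shows "(\<integral>\<^sup>+w. ennreal ((1 - (cmod w)\<^sup>2) powr \<alpha> * cmod (1 - cnj a * w) powr (- c)) * indicator unit_disc w \<partial>lborel)
     \<le> ennreal (3 * pi * (c / (c - 1)) * 2 powr (c - 1)) *
        (\<integral>\<^sup>+x. ennreal (x powr \<alpha> * max x (1 - (cmod a)\<^sup>2) powr (1 - c)) * indicator {0<..1} x \<partial>lborel)"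
proof -
  define d where "d = 1 - (cmod a)\<^sup>2"
  have d: "d > 0" using cmod_square_less_1[OF a] by (simp add: d_def)
  define f where "f w = ennreal ((1 - (cmod w)\<^sup>2) powr \<alpha> * cmod (1 - cnj a * w) powr (- c)) * indicator unit_disc w" for w
  define K where "K = 6 * pi * (c / (c - 1)) * 2 powr (c - 1)"
  have K: "K \<ge> 0" using c by (simp add: K_def)
  define \<psi> where "\<psi> t = ennreal ((1 - t) powr \<alpha> * max (1 - t) d powr (1 - c)) * indicator {..<1} t" for t :: real
  have [measurable]: "\<psi> \<in> borel_measurable borel" unfolding \<psi>_def by measurable
  have [measurable]: "unit_disc \<in> sets borel" by simp
  have [measurable]: "f \<in> borel_measurable borel"
    unfolding f_def by (intro borel_measurable_times_ennreal borel_measurable_indicator) measurable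
  have "ennreal (2 * pi) * (\<integral>\<^sup>+w. f w \<partial>lborel) = (\<integral>\<^sup>+w. (\<integral>\<^sup>+t. f (cis t * w) * indicator {-pi..pi} t \<partial>lborel) \<partial>lborel)"
    using nn_integral_angular_average[of f "-pi" pi] by simp
  also have "\<dots> \<le> (\<integral>\<^sup>+w. ennreal K * \<psi> ((cmod w)\<^sup>2) \<partial>(lborel :: complex measure))"
  proof (intro nn_integral_mono)
    fix w :: complex
    show "(\<integral>\<^sup>+t. f (cis t * w) * indicator {-pi..pi} t \<partial>lborel) \<le> ennreal K * \<psi> ((cmod w)\<^sup>2)"
    proof (cases "w \<in> unit_disc")
      case True
      define \<rho> where "\<rho> = cmod a * cmod w"
      define s where "s = Arg (cnj a * w)"
      have s: "\<bar>s\<bar> \<le> pi" using Arg_bounded[of "cnj a * w"] by (auto simp: s_def)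
      have aw: "cnj a * w = of_real \<rho> * cis s"
        using rcis_cmod_Arg[of "cnj a * w"] by (simp add: rcis_def \<rho>_def s_def norm_mult)
      have \<rho>: "0 \<le> \<rho>" "\<rho> \<le> cmod a" "\<rho> \<le> cmod w"
        using a True by (auto simp: \<rho>_def mult_left_le mult_right_le_one_le mult_left_le_one_le)
      have \<rho>1: "\<rho> < 1" using \<rho>(2) a by simp
      define x where "x = 1 - (cmod w)\<^sup>2"
      have x: "x > 0" using cmod_square_less_1[OF True] by (simp add: x_def)
      have half: "1 - (cmod v)\<^sup>2 \<le> 2 * (1 - cmod v)" for v :: complex
        using zero_le_power2[of "1 - cmod v"] by (simp add: power2_diff)
      have le: "(1 - \<rho>) powr (1 - c) \<le> 2 powr (c - 1) * max x d powr (1 - c)"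
      proof -
        \<comment> \<open>Both \<open>1 - |a|\<close> and \<open>1 - |w|\<close> are at most
          \<open>1 - \<rho>\<close>, and each is at least half of its defect.\<close>
        have "max x d / 2 \<le> 1 - \<rho>" using half[of a] half[of w] \<rho> by (simp add: x_def d_def max_def)
        then have "(1 - \<rho>) powr (1 - c) \<le> (max x d / 2) powr (1 - c)"
          using c x by (intro powr_mono2') auto
        also have "\<dots> = 2 powr (c - 1) * max x d powr (1 - c)"
          using x d by (simp add: powr_divide powr_diff)
        finally show ?thesis .
      qed
      have "(\<integral>\<^sup>+t. f (cis t * w) * indicator {-pi..pi} t \<partial>lborel)
         = (\<integral>\<^sup>+t. ennreal (x powr \<alpha>) * (ennreal (cmod (1 - of_real \<rho> * cis (t + s)) powr (- c)) * indicator {-pi..pi} t) \<partial>lborel)"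
      proof (intro nn_integral_cong)
        fix t
        have "cnj a * (cis t * w) = of_real \<rho> * cis (t + s)"
          using aw by (simp add: mult_ac flip: cis_mult)
        then show "f (cis t * w) * indicator {-pi..pi} t
          = ennreal (x powr \<alpha>) * (ennreal (cmod (1 - of_real \<rho> * cis (t + s)) powr (- c)) * indicator {-pi..pi} t)"
          using True by (simp add: f_def norm_mult x_def ennreal_mult mult.assoc)
      qed
      also have "\<dots> = ennreal (x powr \<alpha>) * (\<integral>\<^sup>+t. ennreal (cmod (1 - of_real \<rho> * cis (t + s)) powr (- c)) * indicator {-pi..pi} t \<partial>lborel)"
      proof (rule nn_integral_cmult)
        have [measurable]: "cis \<in> borel_measurable borel"
          by (intro borel_measurable_continuous_onI continuous_intros)
        show "(\<lambda>t. ennreal (cmod (1 - of_real \<rho> * cis (t + s)) powr (- c)) * indicator {-pi..pi} t) \<in> borel_measurable lborel"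
          by measurable
      qed
      also have "\<dots> \<le> ennreal (x powr \<alpha>) * ennreal (6 * pi * (c / (c - 1)) * (1 - \<rho>) powr (1 - c))"
        by (intro mult_left_mono angular_kernel_bound c \<rho> \<rho>1 s) auto
      also have "\<dots> \<le> ennreal (x powr \<alpha>) * ennreal (6 * pi * (c / (c - 1)) * (2 powr (c - 1) * max x d powr (1 - c)))"
        using c le by (intro mult_left_mono ennreal_leI) auto
      also have "\<dots> = ennreal K * ennreal (x powr \<alpha> * max x d powr (1 - c))"
        using c by (simp add: K_def mult_ac flip: ennreal_mult)
      finally show ?thesis
        using cmod_square_less_1[OF True] by (simp add: \<psi>_def x_def)
    next
      case False
      then have "f (cis t * w) = 0" for t by (simp add: f_def norm_mult)
      then show ?thesis by simp
    qed
  qed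
  also have "\<dots> = ennreal K * (ennreal pi * (\<integral>\<^sup>+t. \<psi> t * indicator {0..} t \<partial>lborel))"
    by (simp add: nn_integral_cmult nn_integral_radial)
  \<comment> \<open>Substitution \<open>x = 1 - t\<close>.\<close>
  also have "(\<integral>\<^sup>+t. \<psi> t * indicator {0..} t \<partial>lborel)
     = (\<integral>\<^sup>+x. ennreal (x powr \<alpha> * max x d powr (1 - c)) * indicator {0<..1} x \<partial>lborel)"
    by (subst nn_integral_real_affine[of _ "-1" 1])
       (auto simp: \<psi>_def indicator_def intro!: nn_integral_cong)
  finally have le: "ennreal (2 * pi) * (\<integral>\<^sup>+w. f w \<partial>lborel)
      \<le> ennreal (2 * pi) * (ennreal (K / 2) * (\<integral>\<^sup>+x. ennreal (x powr \<alpha> * max x d powr (1 - c)) * indicator {0<..1} x \<partial>lborel))"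
    using K by (simp add: mult_ac flip: ennreal_mult mult.assoc)
  have "(\<integral>\<^sup>+w. f w \<partial>lborel) \<le> ennreal (K / 2) * (\<integral>\<^sup>+x. ennreal (x powr \<alpha> * max x d powr (1 - c)) * indicator {0<..1} x \<partial>lborel)"
    using le by (simp add: ennreal_mult_le_mult_iff)
  moreover have "K / 2 = 3 * pi * (c / (c - 1)) * 2 powr (c - 1)"
    using c by (simp add: K_def field_simps)
  ultimately show ?thesis by (simp only: f_def d_def)
qed

text \<open>Split at \<open>x = d\<close>. Below, the maximum is \<open>d\<close> and
  \<open>x^\<alpha>\<close> is integrable at 0 because \<open>\<alpha> > -1\<close>. Above,
  \<open>x^(\<alpha>+1-c)\<close> is integrable up to infinity because
  \<open>c > \<alpha> + 2\<close>, so the bound 1 may be dropped.\<close>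

lemma truncated_powr_integral_less:
  assumes \<alpha>: "\<alpha> > -1" and c: "c > \<alpha> + 2" and d: "d > 0"
  shows "(\<integral>\<^sup>+x. ennreal (x powr \<alpha> * max x d powr (1 - c)) * indicator {0<..1} x \<partial>lborel)
    \<le> ennreal ((1 / (\<alpha> + 1) + 1 / (c - \<alpha> - 2)) * d powr (\<alpha> + 2 - c))"
proof -
  have "(\<integral>\<^sup>+x. ennreal (x powr \<alpha> * max x d powr (1 - c)) * indicator {0<..1} x \<partial>lborel)
    \<le> (\<integral>\<^sup>+x. ennreal (d powr (1 - c)) * (ennreal (x powr \<alpha>) * indicator {0..d} x) + ennreal (x powr (\<alpha> + 1 - c)) * indicator {d..} x \<partial>lborel)"
    using d by (intro nn_integral_mono)
      (auto simp: indicator_def max_def mult.commute add_diff_eq simp flip: ennreal_mult powr_add)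
  also have "\<dots> = ennreal (d powr (1 - c)) * (\<integral>\<^sup>+x. ennreal (x powr \<alpha>) * indicator {0..d} x \<partial>lborel)
     + (\<integral>\<^sup>+x. ennreal (x powr (\<alpha> + 1 - c)) * indicator {d..} x \<partial>lborel)"
    by (simp add: nn_integral_add nn_integral_cmult)
  also have "(\<integral>\<^sup>+x. ennreal (x powr \<alpha>) * indicator {0..d} x \<partial>lborel) = ennreal (d powr (\<alpha> + 1) / (\<alpha> + 1))"
    using \<alpha> d by (intro nn_integral_has_integral_lebesgue' has_integral_powr_from_0) auto
  also have "(\<integral>\<^sup>+x. ennreal (x powr (\<alpha> + 1 - c)) * indicator {d..} x \<partial>lborel) = ennreal (- (d powr (\<alpha> + 1 - c + 1)) / (\<alpha> + 1 - c + 1))"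
    using c d by (intro nn_integral_has_integral_lebesgue' has_integral_powr_to_inf) auto
  also have "- (d powr (\<alpha> + 1 - c + 1)) / (\<alpha> + 1 - c + 1) = d powr (\<alpha> + 2 - c) / (c - \<alpha> - 2)"
  proof -
    have "\<alpha> + 1 - c + 1 = - (c - \<alpha> - 2)" "\<alpha> + 2 - c = - (c - \<alpha> - 2)" by auto
    then show ?thesis by (simp only: minus_divide_divide)
  qed
  also have "ennreal (d powr (1 - c)) * ennreal (d powr (\<alpha> + 1) / (\<alpha> + 1)) = ennreal (d powr (\<alpha> + 2 - c) / (\<alpha> + 1))"
  proof -
    have "d powr (1 - c) * d powr (\<alpha> + 1) = d powr (\<alpha> + 2 - c)" by (simp add: algebra_simps flip: powr_add)
    then show ?thesis using \<alpha> by (simp flip: ennreal_mult)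
  qed
  also have "ennreal (d powr (\<alpha> + 2 - c) / (\<alpha> + 1)) + ennreal (d powr (\<alpha> + 2 - c) / (c - \<alpha> - 2))
    = ennreal ((1 / (\<alpha> + 1) + 1 / (c - \<alpha> - 2)) * d powr (\<alpha> + 2 - c))"
    using \<alpha> c by (simp add: distrib_right flip: ennreal_plus)
  finally show ?thesis .
qed

text \<open>The critical exponent \<open>c = \<alpha> + 2\<close>: above \<open>d\<close> the
  integrand is \<open>1 / x\<close>, which produces the logarithm, while the part below
  \<open>d\<close> contributes only a constant.\<close>

lemma truncated_powr_integral_eq:
  assumes \<alpha>: "\<alpha> > -1" and d: "0 < d" "d \<le> 1"
  shows "(\<integral>\<^sup>+x. ennreal (x powr \<alpha> * max x d powr (1 - (\<alpha> + 2))) * indicator {0<..1} x \<partial>lborel)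
    \<le> ennreal (1 / (\<alpha> + 1) - ln d)"
proof -
  have "(\<integral>\<^sup>+x. ennreal (x powr \<alpha> * max x d powr (1 - (\<alpha> + 2))) * indicator {0<..1} x \<partial>lborel)
    \<le> (\<integral>\<^sup>+x. ennreal (d powr (1 - (\<alpha> + 2))) * (ennreal (x powr \<alpha>) * indicator {0..d} x) + ennreal (1 / x) * indicator {d..1} x \<partial>lborel)"
  proof (intro nn_integral_mono)
    fix x :: real
    have "x powr \<alpha> * x powr (1 - (\<alpha> + 2)) = 1 / x" if "x > 0"
      using that by (simp add: powr_minus_divide flip: powr_add)
    then show "ennreal (x powr \<alpha> * max x d powr (1 - (\<alpha> + 2))) * indicator {0<..1} x
       \<le> ennreal (d powr (1 - (\<alpha> + 2))) * (ennreal (x powr \<alpha>) * indicator {0..d} x) + ennreal (1 / x) * indicator {d..1} x"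
      using d by (auto simp: indicator_def max_def mult.commute simp flip: ennreal_mult)
  qed
  also have "\<dots> = ennreal (d powr (1 - (\<alpha> + 2))) * (\<integral>\<^sup>+x. ennreal (x powr \<alpha>) * indicator {0..d} x \<partial>lborel)
     + (\<integral>\<^sup>+x. ennreal (1 / x) * indicator {d..1} x \<partial>lborel)"
    by (simp add: nn_integral_add nn_integral_cmult)
  also have "(\<integral>\<^sup>+x. ennreal (x powr \<alpha>) * indicator {0..d} x \<partial>lborel) = ennreal (d powr (\<alpha> + 1) / (\<alpha> + 1))"
    using \<alpha> d by (intro nn_integral_has_integral_lebesgue' has_integral_powr_from_0) auto
  also have "(\<integral>\<^sup>+x. ennreal (1 / x) * indicator {d..1} x \<partial>lborel) = ennreal (ln 1 - ln d)"
    using d by (intro nn_integral_FTC_Icc) (auto intro!: derivative_eq_intros)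
  also have "ennreal (d powr (1 - (\<alpha> + 2))) * ennreal (d powr (\<alpha> + 1) / (\<alpha> + 1)) = ennreal (1 / (\<alpha> + 1))"
  proof -
    have "d powr (1 - (\<alpha> + 2)) * d powr (\<alpha> + 1) = 1" using d by (simp flip: powr_add)
    then show ?thesis using \<alpha> by (simp flip: ennreal_mult)
  qed
  also have "ennreal (1 / (\<alpha> + 1)) + ennreal (ln 1 - ln d) = ennreal (1 / (\<alpha> + 1) - ln d)"
    using \<alpha> d by (simp flip: ennreal_plus)
  finally show ?thesis .
qed

section \<open>Order boundedness and test functions\<close>

text \<open>On the convex disc \<open>f * deriv g\<close> has a primitive \<open>F\<close>, and the
  integral along the segment from 0 to \<open>z\<close> equals \<open>F z - F 0\<close>.\<close>

lemma volterra_deriv: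
  assumes f: "f holomorphic_on unit_disc" and g: "g holomorphic_on unit_disc"
  shows "volterra g f holomorphic_on unit_disc"
    and "z \<in> unit_disc \<Longrightarrow> deriv (volterra g f) z = f z * deriv g z"
proof -
  have "(\<lambda>w. f w * deriv g w) holomorphic_on unit_disc"
    by (intro holomorphic_intros f g) auto
  then obtain F where F: "\<And>z. z \<in> unit_disc \<Longrightarrow> (F has_field_derivative f z * deriv g z) (at z within unit_disc)"
    using holomorphic_convex_primitive'[of unit_disc "\<lambda>w. f w * deriv g w"] by auto
  have eq: "volterra g f z = F z - F 0" if z: "z \<in> unit_disc" for z
  proof -
    have "closed_segment 0 z \<subseteq> unit_disc"
      using z by (intro closed_segment_subset) auto
    then have "((\<lambda>w. f w * deriv g w) has_contour_integral (F (pathfinish (linepath 0 z)) - F (pathstart (linepath 0 z)))) (linepath 0 z)"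
      by (intro contour_integral_primitive[OF F]) auto
    then show ?thesis unfolding volterra_def by (simp add: contour_integral_unique)
  qed
  have D: "(volterra g f has_field_derivative f z * deriv g z) (at z)" if z: "z \<in> unit_disc" for z
  proof -
    have "(F has_field_derivative f z * deriv g z) (at z)"
      using F[OF z] z at_within_open[OF z open_ball] by simp
    then have "((\<lambda>z. F z - F 0) has_field_derivative f z * deriv g z) (at z)"
      by (auto intro!: derivative_eq_intros)
    then show ?thesis
      by (rule has_field_derivative_transform_within_open[where S = unit_disc]) (use z eq in auto)
  qed
  then show "volterra g f holomorphic_on unit_disc"
    by (subst holomorphic_on_open) (auto intro!: exI)
  show "z \<in> unit_disc \<Longrightarrow> deriv (volterra g f) z = f z * deriv g z"
    using D by (simp add: DERIV_imp_deriv)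
qed

lemma dirichlet_scale:
  assumes p: "0 < p" and s: "0 \<le> s" and f: "f \<in> dirichlet_space \<alpha> p"
  shows "(\<lambda>z. of_real s * f z) \<in> dirichlet_space \<alpha> p"
    and "dirichlet_norm \<alpha> p (\<lambda>z. of_real s * f z) = s * dirichlet_norm \<alpha> p f"
proof -
  have hol: "f holomorphic_on unit_disc" and fin: "dirichlet_integral \<alpha> p f < \<infinity>"
    using f by (auto simp: dirichlet_space_def)
  have [measurable]: "deriv f \<in> borel_measurable (weighted_area \<alpha>)"
    by (rule borel_measurable_weighted_area_continuous[OF continuous_on_deriv_disc[OF hol]])
  have d: "deriv (\<lambda>z. of_real s * f z) z = of_real s * deriv f z" if "z \<in> unit_disc" for z
    using that hol by (intro deriv_cmult holomorphic_on_imp_differentiable_at[OF _ open_ball]) auto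
  have "dirichlet_integral \<alpha> p (\<lambda>z. of_real s * f z) = (\<integral>\<^sup>+z. ennreal (s powr p) * ennreal (cmod (deriv f z) powr p) \<partial>weighted_area \<alpha>)"
    unfolding dirichlet_integral_def using s
    by (intro nn_integral_cong) (simp add: d norm_mult powr_mult ennreal_mult)
  also have "\<dots> = ennreal (s powr p) * dirichlet_integral \<alpha> p f"
    unfolding dirichlet_integral_def by (intro nn_integral_cmult) measurable
  finally have I: "dirichlet_integral \<alpha> p (\<lambda>z. of_real s * f z) = ennreal (s powr p) * dirichlet_integral \<alpha> p f" .
  then show "(\<lambda>z. of_real s * f z) \<in> dirichlet_space \<alpha> p"
    using fin hol by (auto simp: dirichlet_space_def ennreal_mult_less_top less_top intro!: holomorphic_intros)
  show "dirichlet_norm \<alpha> p (\<lambda>z. of_real s * f z) = s * dirichlet_norm \<alpha> p f"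
  proof -
    have "dirichlet_norm \<alpha> p (\<lambda>z. of_real s * f z)
        = (s powr p * (cmod (f 0) powr p + enn2real (dirichlet_integral \<alpha> p f))) powr (1 / p)"
      using s by (simp add: dirichlet_norm_def I enn2real_mult norm_mult powr_mult distrib_left)
    also have "\<dots> = s * dirichlet_norm \<alpha> p f"
      using s p by (simp add: dirichlet_norm_def powr_mult powr_powr)
    finally show ?thesis .
  qed
qed

text \<open>The factor \<open>s\<close> depends on the bounds \<open>A\<close> and \<open>B\<close>
  only, so one \<open>s\<close> normalizes a whole family of test functions. The summand 1 keeps its
  denominator positive.\<close>

lemma normalized_in_dirichlet_space:
  assumes p: "0 < p" and hol: "f holomorphic_on unit_disc"
    and f0: "cmod (f 0) \<le> A" and I: "dirichlet_integral \<alpha> p f \<le> ennreal B" and B: "0 \<le> B"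
  defines "s \<equiv> inverse ((A powr p + B + 1) powr (1 / p))"
  shows "(\<lambda>z. of_real s * f z) \<in> dirichlet_space \<alpha> p"
    and "dirichlet_norm \<alpha> p (\<lambda>z. of_real s * f z) \<le> 1"
proof -
  have f: "f \<in> dirichlet_space \<alpha> p"
    using hol I by (auto simp: dirichlet_space_def intro: le_less_trans)
  have "enn2real (dirichlet_integral \<alpha> p f) \<le> B"
    using enn2real_mono[OF I] B by simp
  moreover have "cmod (f 0) powr p \<le> A powr p"
    using f0 p by (intro powr_mono2) auto
  ultimately have "dirichlet_norm \<alpha> p f \<le> (A powr p + B + 1) powr (1 / p)"
    unfolding dirichlet_norm_def using p by (intro powr_mono2) auto
  moreover have "(A powr p + B + 1) powr (1 / p) > 0"
    using B powr_ge_zero[of A p] by (metis add_nonneg_pos add_nonneg_nonneg less_numeral_extra(1,3) powr_gt_zero)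
  ultimately have "s * dirichlet_norm \<alpha> p f \<le> 1"
    by (simp add: s_def field_simps)
  moreover have s: "s \<ge> 0" by (simp add: s_def)
  ultimately show "dirichlet_norm \<alpha> p (\<lambda>z. of_real s * f z) \<le> 1"
    using dirichlet_scale(2)[OF p s f] by simp
  show "(\<lambda>z. of_real s * f z) \<in> dirichlet_space \<alpha> p"
    by (rule dirichlet_scale(1)[OF p s f])
qed

text \<open>Each \<open>f\<close> in the unit ball has its own exceptional null set. Continuity of \<open>a \<mapsto> k a z\<close> lets
  countably many \<open>k a\<close> stand for all of them, so that \<open>a = z\<close> may be chosen afterwards.\<close>

lemma order_bounded_volterra_iff:
  assumes p: "0 < p" and q: "0 < q" and g: "g holomorphic_on unit_disc"
    and \<Phi>: "continuous_on unit_disc \<Phi>" "\<And>z. z \<in> unit_disc \<Longrightarrow> 0 < \<Phi> z"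
    and growth: "\<And>f z. \<lbrakk>f \<in> dirichlet_space \<alpha> p; dirichlet_norm \<alpha> p f \<le> 1; z \<in> unit_disc\<rbrakk> \<Longrightarrow> cmod (f z) \<le> C * \<Phi> z"
    and k: "\<And>a. a \<in> unit_disc \<Longrightarrow> k a \<in> dirichlet_space \<alpha> p"
      "\<And>a. a \<in> unit_disc \<Longrightarrow> dirichlet_norm \<alpha> p (k a) \<le> 1"
      "\<And>z. z \<in> unit_disc \<Longrightarrow> continuous_on unit_disc (\<lambda>a. k a z)"
    and c: "0 < c" "\<And>a. a \<in> unit_disc \<Longrightarrow> c * \<Phi> a \<le> cmod (k a a)"
  shows "order_bounded \<alpha> p \<beta> q (volterra g) \<longleftrightarrow>
    (\<integral>\<^sup>+z. ennreal ((cmod (deriv g z) * \<Phi> z) powr q) \<partial>weighted_area \<beta>) < \<infinity>"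
    (is "_ \<longleftrightarrow> ?I < \<infinity>")
proof
  assume "order_bounded \<alpha> p \<beta> q (volterra g)"
  then obtain h where h: "h \<in> Lebesgue_space q (weighted_area \<beta>)" "\<And>z. z \<in> unit_disc \<Longrightarrow> 0 \<le> h z"
    "\<And>f. \<lbrakk>f \<in> dirichlet_space \<alpha> p; dirichlet_norm \<alpha> p f \<le> 1\<rbrakk> \<Longrightarrow> AE z in weighted_area \<beta>. cmod (deriv (volterra g f) z) \<le> h z"
    unfolding order_bounded_def by blast
  from h(1) have [measurable]: "h \<in> borel_measurable (weighted_area \<beta>)"
    and hfin: "(\<integral>\<^sup>+z. ennreal (\<bar>h z\<bar> powr q) \<partial>weighted_area \<beta>) < \<infinity>"
    by (auto simp: Lebesgue_space_def)
  obtain T :: "complex set" where T: "countable T" "T \<subseteq> unit_disc" "unit_disc \<subseteq> closure T"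
    by (rule separable)
  have "AE z in weighted_area \<beta>. \<forall>a\<in>T. cmod (deriv (volterra g (k a)) z) \<le> h z"
    using T by (subst AE_ball_countable) (auto intro!: h k)
  then have "AE z in weighted_area \<beta>. c * (cmod (deriv g z) * \<Phi> z) \<le> h z"
  proof (rule AE_mp, intro AE_I2 impI)
    fix z assume "z \<in> space (weighted_area \<beta>)" and le: "\<forall>a\<in>T. cmod (deriv (volterra g (k a)) z) \<le> h z"
    then have z: "z \<in> unit_disc" by simp
    have "k a holomorphic_on unit_disc" if "a \<in> T" for a
      using k(1)[of a] that T(2) by (auto simp: dirichlet_space_def)
    then have leT: "cmod (k a z * deriv g z) \<le> h z" if "a \<in> T" for a
      using le that volterra_deriv(2)[OF _ g z, of "k a"] by auto
    have "z \<in> closure T" using z T(3) by blast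
    then obtain X where X: "\<And>n. X n \<in> T" "X \<longlonglongrightarrow> z"
      unfolding closure_sequential by blast
    \<comment> \<open>Here \<open>z\<close> is fixed outside one null set common to all of
      \<open>T\<close>, so the parameter can tend to \<open>z\<close> in the pointwise
      inequality.\<close>
    have "(\<lambda>n. k (X n) z) \<longlonglongrightarrow> k z z"
      by (rule continuous_on_tendsto_compose[OF k(3)[OF z] X(2) z])
         (use X(1) T(2) in \<open>auto simp: subset_iff intro!: always_eventually\<close>)
    then have "(\<lambda>n. cmod (k (X n) z * deriv g z)) \<longlonglongrightarrow> cmod (k z z * deriv g z)"
      by (intro tendsto_intros)
    then have "cmod (k z z * deriv g z) \<le> h z"
      by (rule LIMSEQ_le_const2) (use leT X(1) in auto)
    moreover have "c * \<Phi> z * cmod (deriv g z) \<le> cmod (k z z) * cmod (deriv g z)"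
      by (intro mult_right_mono c(2) z) auto
    ultimately show "c * (cmod (deriv g z) * \<Phi> z) \<le> h z"
      by (simp add: norm_mult mult_ac)
  qed
  then have "?I \<le> (\<integral>\<^sup>+z. ennreal (c powr (- q)) * ennreal (\<bar>h z\<bar> powr q) \<partial>weighted_area \<beta>)"
  proof (intro nn_integral_mono_AE, elim AE_mp, intro AE_I2 impI)
    fix z assume "z \<in> space (weighted_area \<beta>)" and le: "c * (cmod (deriv g z) * \<Phi> z) \<le> h z"
    then have z: "0 \<le> \<Phi> z" using \<Phi>(2)[of z] by simp
    have "(c * (cmod (deriv g z) * \<Phi> z)) powr q \<le> \<bar>h z\<bar> powr q"
      using le c(1) z q by (intro powr_mono2) auto
    then have "(cmod (deriv g z) * \<Phi> z) powr q \<le> c powr (- q) * \<bar>h z\<bar> powr q"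
      using c(1) z by (subst (asm) powr_mult) (auto simp: powr_minus field_simps)
    then show "ennreal ((cmod (deriv g z) * \<Phi> z) powr q) \<le> ennreal (c powr (- q)) * ennreal (\<bar>h z\<bar> powr q)"
      by (simp flip: ennreal_mult)
  qed
  also have "\<dots> = ennreal (c powr (- q)) * (\<integral>\<^sup>+z. ennreal (\<bar>h z\<bar> powr q) \<partial>weighted_area \<beta>)"
    by (rule nn_integral_cmult) measurable
  also have "\<dots> < \<infinity>" using hfin by (simp add: ennreal_mult_less_top less_top)
  finally show "?I < \<infinity>" .
next
  assume fin: "?I < \<infinity>"
  have cont: "continuous_on unit_disc (\<lambda>z. cmod (deriv g z) * \<Phi> z)"
    by (intro continuous_intros \<Phi> continuous_on_deriv_disc[OF g])
  have [measurable]: "(\<lambda>z. cmod (deriv g z) * \<Phi> z) \<in> borel_measurable (weighted_area \<beta>)"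
    by (rule borel_measurable_weighted_area_continuous[OF cont])
  have scaled: "(\<integral>\<^sup>+z. ennreal (\<bar>s * (cmod (deriv g z) * \<Phi> z)\<bar> powr q) \<partial>weighted_area \<beta>) < \<infinity>" for s :: real
  proof -
    have "(\<integral>\<^sup>+z. ennreal (\<bar>s * (cmod (deriv g z) * \<Phi> z)\<bar> powr q) \<partial>weighted_area \<beta>)
        = (\<integral>\<^sup>+z. ennreal (\<bar>s\<bar> powr q) * ennreal ((cmod (deriv g z) * \<Phi> z) powr q) \<partial>weighted_area \<beta>)"
      using \<Phi>(2) by (intro nn_integral_cong) (auto simp: abs_mult powr_mult less_imp_le simp flip: ennreal_mult)
    also have "\<dots> = ennreal (\<bar>s\<bar> powr q) * ?I"
      by (rule nn_integral_cmult) measurable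
    also have "\<dots> < \<infinity>" using fin by (simp add: ennreal_mult_less_top less_top)
    finally show ?thesis .
  qed
  have "0 \<in> unit_disc" by simp
  \<comment> \<open>The sign of \<open>C\<close> is read off from the growth bound for a test
    function at the origin.\<close>
  have "0 \<le> C * \<Phi> 0"
    using growth[OF k(1,2)[OF \<open>0 \<in> unit_disc\<close>] \<open>0 \<in> unit_disc\<close>] norm_ge_zero order_trans by blast
  then have C: "C \<ge> 0" using \<Phi>(2)[of 0] by (simp add: zero_le_mult_iff)
  have hol: "f holomorphic_on unit_disc" if "f \<in> dirichlet_space \<alpha> p" for f
    using that by (simp add: dirichlet_space_def)
  show "order_bounded \<alpha> p \<beta> q (volterra g)"
    unfolding order_bounded_def
  proof (intro conjI bexI[of _ "\<lambda>z. C * (cmod (deriv g z) * \<Phi> z)"] ballI impI)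
    show "(\<lambda>z. C * (cmod (deriv g z) * \<Phi> z)) \<in> Lebesgue_space q (weighted_area \<beta>)"
      unfolding Lebesgue_space_def using scaled[of C] by simp
    show "0 \<le> C * (cmod (deriv g z) * \<Phi> z)" if "z \<in> unit_disc" for z
      using C \<Phi>(2)[OF that] by simp
    show "AE z in weighted_area \<beta>. cmod (deriv (volterra g f) z) \<le> C * (cmod (deriv g z) * \<Phi> z)"
      if f: "f \<in> dirichlet_space \<alpha> p" "dirichlet_norm \<alpha> p f \<le> 1" for f
    proof (rule AE_I2)
      fix z assume "z \<in> space (weighted_area \<beta>)"
      then have z: "z \<in> unit_disc" by simp
      show "cmod (deriv (volterra g f) z) \<le> C * (cmod (deriv g z) * \<Phi> z)"
        using mult_right_mono[OF growth[OF f z], of "cmod (deriv g z)"]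
        by (simp add: volterra_deriv(2)[OF hol[OF f(1)] g z] norm_mult mult_ac)
    qed
    \<comment> \<open>That the operator maps into the target space follows from the same bound,
      rescaled to an arbitrary \<open>f\<close>. The 1 in \<open>N\<close> permits division also
      when the norm is 0.\<close>
    show "volterra g ` dirichlet_space \<alpha> p \<subseteq> dirichlet_space \<beta> q"
    proof (rule image_subsetI)
      fix f assume f: "f \<in> dirichlet_space \<alpha> p"
      define N where "N = 1 + dirichlet_norm \<alpha> p f"
      have N: "N \<ge> 1" "dirichlet_norm \<alpha> p f \<le> N" by (auto simp: N_def dirichlet_norm_def)
      have bound: "cmod (f z) \<le> N * (C * \<Phi> z)" if z: "z \<in> unit_disc" for z
      proof -
        have N': "inverse N \<ge> 0" using N by simp
        have "dirichlet_norm \<alpha> p (\<lambda>z. of_real (inverse N) * f z) \<le> 1"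
          unfolding dirichlet_scale(2)[OF p N' f] using N by (simp add: field_simps)
        from growth[OF dirichlet_scale(1)[OF p N' f] this z] show ?thesis
          using N by (simp add: norm_mult norm_divide norm_inverse field_simps)
      qed
      have "dirichlet_integral \<beta> q (volterra g f) \<le> (\<integral>\<^sup>+z. ennreal (\<bar>N * C * (cmod (deriv g z) * \<Phi> z)\<bar> powr q) \<partial>weighted_area \<beta>)"
        unfolding dirichlet_integral_def
      proof (intro nn_integral_mono ennreal_leI powr_mono2)
        fix z assume "z \<in> space (weighted_area \<beta>)"
        then have z: "z \<in> unit_disc" by simp
        have "cmod (f z) * cmod (deriv g z) \<le> N * C * (cmod (deriv g z) * \<Phi> z)"
          using mult_right_mono[OF bound[OF z], of "cmod (deriv g z)"] by (simp add: mult_ac)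
        then show "cmod (deriv (volterra g f) z) \<le> \<bar>N * C * (cmod (deriv g z) * \<Phi> z)\<bar>"
          by (simp add: volterra_deriv(2)[OF hol[OF f] g z] norm_mult)
      qed (use q in auto)
      also have "\<dots> < \<infinity>" by (rule scaled)
      finally show "volterra g f \<in> dirichlet_space \<beta> q"
        using volterra_deriv(1)[OF hol[OF f] g] by (simp add: dirichlet_space_def)
    qed
  qed
qed

text \<open>Shared by both nonconstant test families: \<open>M\<close> carries the p-th power of the
  factor in front of the test function, \<open>J\<close> the size of the one-dimensional integral,
  and in \<open>M * J\<close> the dependence on \<open>a\<close> will cancel.\<close>

lemma dirichlet_integral_le_kernel:
  assumes c: "c > 1" and a: "a \<in> unit_disc" and f: "f holomorphic_on unit_disc" and M: "0 \<le> M"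
    and le: "\<And>w. w \<in> unit_disc \<Longrightarrow> cmod (deriv f w) powr p \<le> M * cmod (1 - cnj a * w) powr (- c)"
    and J: "(\<integral>\<^sup>+x. ennreal (x powr \<alpha> * max x (1 - (cmod a)\<^sup>2) powr (1 - c)) * indicator {0<..1} x \<partial>lborel) \<le> ennreal J"
    and J0: "0 \<le> J"
  shows "dirichlet_integral \<alpha> p f \<le> ennreal (3 * (c / (c - 1)) * 2 powr (c - 1) * (M * J))"
proof -
  let ?k = "\<lambda>w. ennreal ((1 - (cmod w)\<^sup>2) powr \<alpha> * cmod (1 - cnj a * w) powr (- c)) * indicator unit_disc w"
  let ?K = "3 * pi * (c / (c - 1)) * 2 powr (c - 1)"
  have [measurable]: "?k \<in> borel_measurable borel"
    by (intro borel_measurable_times_ennreal borel_measurable_indicator) measurable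
  have "(\<integral>\<^sup>+w. ennreal ((1 - (cmod w)\<^sup>2) powr \<alpha> * cmod (deriv f w) powr p) * indicator unit_disc w \<partial>lborel)
     \<le> (\<integral>\<^sup>+w. ennreal M * ?k w \<partial>lborel)"
  proof (intro nn_integral_mono)
    fix w
    show "ennreal ((1 - (cmod w)\<^sup>2) powr \<alpha> * cmod (deriv f w) powr p) * indicator unit_disc w \<le> ennreal M * ?k w"
    proof (cases "w \<in> unit_disc")
      case True
      have "(1 - (cmod w)\<^sup>2) powr \<alpha> * cmod (deriv f w) powr p \<le> (1 - (cmod w)\<^sup>2) powr \<alpha> * (M * cmod (1 - cnj a * w) powr (- c))"
        by (intro mult_left_mono le True) auto
      then show ?thesis using True M by (simp add: mult_ac flip: ennreal_mult)
    qed simp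
  qed
  also have "\<dots> = ennreal M * (\<integral>\<^sup>+w. ?k w \<partial>lborel)"
    by (rule nn_integral_cmult) measurable
  also have "\<dots> \<le> ennreal M * (ennreal ?K * ennreal J)"
    by (intro mult_left_mono order_trans[OF kernel_integral_bound[OF c a]] J) auto
  finally have "dirichlet_integral \<alpha> p f \<le> ennreal (1 / pi) * (ennreal M * (ennreal ?K * ennreal J))"
    unfolding dirichlet_integral_lborel[OF f] by (rule mult_left_mono) simp
  also have "\<dots> = ennreal (1 / pi * (M * (?K * J)))"
    using M J0 c by (simp flip: ennreal_mult)
  also have "1 / pi * (M * (?K * J)) = 3 * (c / (c - 1)) * 2 powr (c - 1) * (M * J)"
    by simp
  finally show ?thesis .
qed

section \<open>The three cases, each with its growth function and test family\<close>

lemma one_minus_cnj_mult: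
  assumes "a \<in> unit_disc" "z \<in> unit_disc"
  shows "Re (1 - cnj a * z) > 0" "1 - cnj a * z \<noteq> 0"
proof -
  have "cmod a * cmod z < 1"
    using assms mult_strict_mono'[of "cmod a" 1 "cmod z" 1] by simp
  then have "Re (cnj a * z) < 1"
    using complex_Re_le_cmod[of "cnj a * z"] by (simp add: norm_mult)
  then show "Re (1 - cnj a * z) > 0" by simp
  then show "1 - cnj a * z \<noteq> 0" by (metis less_irrefl zero_complex.sel(1))
qed

lemma one_minus_cnj_self: "1 - cnj a * a = of_real (1 - (cmod a)\<^sup>2)"
  using complex_norm_square[of a] by (simp add: mult.commute)

lemma defect_bounds:
  assumes "a \<in> unit_disc"
  shows "0 < 1 - (cmod a)\<^sup>2" "1 - (cmod a)\<^sup>2 \<le> 1" "1 - (cmod a)\<^sup>2 \<le> 2 * (1 - cmod a)"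
  using cmod_square_less_1[OF assms] zero_le_power2[of "1 - cmod a"]
  by (simp_all add: power2_diff)

text \<open>With \<open>d = 1 - |a|^2\<close> and \<open>s = (\<alpha> + 2) / p\<close>, the factor
  \<open>d^(n+1-s)\<close> has p-th power \<open>d^(c-\<alpha>-2)\<close>, the reciprocal of the
  kernel integral up to constants. On the diagonal it leaves
  \<open>d^(n+1-s) * d^(-n) = d^(1-s)\<close>, which matches the upper growth bound.\<close>

lemma order_bounded_volterra_less:
  assumes \<alpha>: "\<alpha> > -1" and p: "0 < p" and q: "0 < q" and g: "g holomorphic_on unit_disc" and less: "p < \<alpha> + 2"
  shows "order_bounded \<alpha> p \<beta> q (volterra g) \<longleftrightarrow>
    (\<integral>\<^sup>+z. ennreal ((cmod (deriv g z) * (1 - (cmod z)\<^sup>2) powr (1 - (\<alpha> + 2) / p)) powr q) \<partial>weighted_area \<beta>) < \<infinity>"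
proof -
  define s where "s = (\<alpha> + 2) / p"
  have s: "s > 1" using less p by (simp add: s_def)
  \<comment> \<open>The least natural number with \<open>n + 1 > s\<close>, so that
    \<open>c > \<alpha> + 2\<close>; it is positive because \<open>s > 1\<close>.\<close>
  define n where "n = nat \<lfloor>s\<rfloor>"
  have n: "real n + 1 > s" "n > 0" using s by (simp_all add: n_def)
  define c where "c = (real n + 1) * p"
  have c: "c > \<alpha> + 2" using n p by (simp add: c_def s_def field_simps)
  define f where "f a z = of_real ((1 - (cmod a)\<^sup>2) powr (real n + 1 - s)) * inverse (1 - cnj a * z) ^ n" for a z
  define J where "J = 1 / (\<alpha> + 1) + 1 / (c - \<alpha> - 2)"
  define B where "B = 3 * (c / (c - 1)) * 2 powr (c - 1) * (real n powr p * J)"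
  have B: "B \<ge> 0" using \<alpha> c by (simp add: B_def J_def)
  define t where "t = inverse ((1 powr p + B + 1) powr (1 / p))"
  have t: "t > 0" using B by (simp add: t_def)
  obtain C where C: "C > 0"
    "\<And>f z. \<lbrakk>f \<in> dirichlet_space \<alpha> p; dirichlet_norm \<alpha> p f \<le> 1; z \<in> unit_disc\<rbrakk> \<Longrightarrow>
      cmod (f z) \<le> 1 + C * (((1 - cmod z) powr (1 - (\<alpha> + 2) / p) - 1) / ((\<alpha> + 2) / p - 1))"
    by (rule growth_powr[OF p, of \<alpha>]) (use less in \<open>auto intro: that\<close>)
  have hol: "f a holomorphic_on unit_disc" if "a \<in> unit_disc" for a
    unfolding f_def using one_minus_cnj_mult(2)[OF that] by (intro holomorphic_intros) auto
  have f0: "cmod (f a 0) \<le> 1" if "a \<in> unit_disc" for a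
    using defect_bounds[OF that] n(1) by (simp add: f_def powr_le1)
  have int: "dirichlet_integral \<alpha> p (f a) \<le> ennreal B" if a: "a \<in> unit_disc" for a
  proof -
    define d where "d = 1 - (cmod a)\<^sup>2"
    have d: "d > 0" "d \<le> 1" using defect_bounds[OF a] by (simp_all add: d_def)
    have "dirichlet_integral \<alpha> p (f a) \<le> ennreal (3 * (c / (c - 1)) * 2 powr (c - 1) * (real n powr p * d powr (c - \<alpha> - 2) * (J * d powr (\<alpha> + 2 - c))))"
    proof (rule dirichlet_integral_le_kernel[OF _ a hol[OF a]])
      show "(\<integral>\<^sup>+x. ennreal (x powr \<alpha> * max x (1 - (cmod a)\<^sup>2) powr (1 - c)) * indicator {0<..1} x \<partial>lborel) \<le> ennreal (J * d powr (\<alpha> + 2 - c))"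
        unfolding J_def d_def[symmetric] by (rule truncated_powr_integral_less[OF \<alpha> c d(1)])
      fix w assume w: "w \<in> unit_disc"
      let ?v = "1 - cnj a * w"
      have v: "?v \<noteq> 0" by (rule one_minus_cnj_mult(2)[OF a w])
      have "(f a has_field_derivative of_real (d powr (real n + 1 - s)) * (of_nat n * cnj a * inverse ?v ^ (n + 1))) (at w)"
      proof -
        obtain m where m: "n = Suc m" using n(2) gr0_conv_Suc by auto
        have "((\<lambda>z. inverse (1 - cnj a * z)) has_field_derivative cnj a * inverse ?v ^ 2) (at w)"
          using v by (auto intro!: derivative_eq_intros simp: power2_eq_square)
        from DERIV_cmult[OF DERIV_power[OF this, of n], of "of_real (d powr (real n + 1 - s))"] show ?thesis
          unfolding f_def d_def m by (simp add: power2_eq_square mult_ac)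
      qed
      then have "deriv (f a) w = of_real (d powr (real n + 1 - s)) * (of_nat n * cnj a * inverse ?v ^ (n + 1))"
        by (rule DERIV_imp_deriv)
      then have "cmod (deriv (f a) w) = d powr (real n + 1 - s) * (real n * cmod a * inverse (cmod ?v) ^ (n + 1))"
        by (simp add: norm_mult norm_power norm_inverse)
      also have "\<dots> \<le> d powr (real n + 1 - s) * (real n * 1 * inverse (cmod ?v) ^ (n + 1))"
        using a by (intro mult_left_mono mult_right_mono) auto
      also have "inverse (cmod ?v) ^ (n + 1) = cmod ?v powr (- (real n + 1))"
      proof -
        have "cmod ?v powr (- real (n + 1)) = inverse (cmod ?v ^ (n + 1))"
          unfolding powr_minus using v by (subst powr_realpow) auto
        then show ?thesis by (simp only: power_inverse of_nat_add of_nat_1)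
      qed
      finally have "cmod (deriv (f a) w) powr p \<le> (d powr (real n + 1 - s) * (real n * 1 * cmod ?v powr (- (real n + 1)))) powr p"
        using p by (intro powr_mono2) auto
      also have "\<dots> = d powr ((real n + 1 - s) * p) * (real n powr p * cmod ?v powr (- (real n + 1) * p))"
        by (simp add: powr_mult powr_powr)
      also have "(real n + 1 - s) * p = c - \<alpha> - 2" using p by (simp add: c_def s_def field_simps)
      also have "- (real n + 1) * p = - c" unfolding c_def by (rule mult_minus_left)
      finally show "cmod (deriv (f a) w) powr p \<le> real n powr p * d powr (c - \<alpha> - 2) * cmod ?v powr (- c)"
        by (simp add: mult_ac)
    qed (use \<alpha> c J_def in auto)
    also have "real n powr p * d powr (c - \<alpha> - 2) * (J * d powr (\<alpha> + 2 - c)) = real n powr p * J"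
    proof -
      have "d powr (c - \<alpha> - 2) * d powr (\<alpha> + 2 - c) = 1" using d by (simp flip: powr_add)
      then show ?thesis by (simp add: mult_ac)
    qed
    finally show ?thesis by (simp add: B_def)
  qed
  show ?thesis
  \<comment> \<open>In \<open>C\<close>, the 1 absorbs the bound for \<open>f 0\<close>, since
    \<open>(1 - |z|^2)^(1-s) \<ge> 1\<close>, and \<open>2 powr (s - 1)\<close> is the price for
    replacing \<open>1 - |z|\<close> by \<open>1 - |z|^2\<close>.\<close>
  proof (rule order_bounded_volterra_iff[OF p q g, where k = "\<lambda>a z. of_real t * f a z" and c = t
        and C = "1 + C * 2 powr (s - 1) / (s - 1)"], goal_cases)
    case 1
    show ?case using defect_bounds(1) by (intro continuous_intros continuous_on_powr') (auto simp: less_imp_neq[symmetric])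
  next
    case (2 z)
    show ?case using defect_bounds(1)[OF 2] by simp
  next
    case (3 f z)
    let ?d = "1 - (cmod z)\<^sup>2"
    note d = defect_bounds[OF 3(3)]
    have "(1 - cmod z) powr (1 - s) \<le> (?d / 2) powr (1 - s)"
      using d s by (intro powr_mono2') auto
    also have "\<dots> = 2 powr (s - 1) * ?d powr (1 - s)"
      using d by (simp add: powr_divide powr_diff)
    finally have 1: "((1 - cmod z) powr (1 - s) - 1) / (s - 1) \<le> 2 powr (s - 1) * ?d powr (1 - s) / (s - 1)"
      using s by (intro divide_right_mono) auto
    have 2: "1 \<le> ?d powr (1 - s)"
      using powr_mono2'[of "1 - s" ?d 1] d s by simp
    have "cmod (f z) \<le> 1 + C * (((1 - cmod z) powr (1 - s) - 1) / (s - 1))"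
      using C(2)[OF 3] by (simp add: s_def)
    also have "\<dots> \<le> ?d powr (1 - s) + C * (2 powr (s - 1) * ?d powr (1 - s) / (s - 1))"
      using C(1) by (intro add_mono 2 mult_left_mono 1) auto
    finally show ?case by (simp add: s_def algebra_simps)
  next
    case (4 a)
    show ?case using normalized_in_dirichlet_space(1)[OF p hol[OF 4] f0[OF 4] int[OF 4] B] by (simp add: t_def)
  next
    case (5 a)
    show ?case using normalized_in_dirichlet_space(2)[OF p hol[OF 5] f0[OF 5] int[OF 5] B] by (simp add: t_def)
  next
    case (6 z)
    show ?case
      unfolding f_def using one_minus_cnj_mult(2)[OF _ 6] defect_bounds(1)
      by (intro continuous_intros continuous_on_powr') (auto simp: less_imp_neq[symmetric])
  next
    case 7
    show ?case by (rule t)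
  next
    case (8 a)
    define d where "d = 1 - (cmod a)\<^sup>2"
    have d: "d > 0" using defect_bounds(1)[OF 8] by (simp add: d_def)
    have "cmod (f a a) = d powr (real n + 1 - s) * inverse d ^ n"
      unfolding f_def one_minus_cnj_self d_def[symmetric] using d by (simp add: norm_mult norm_power norm_inverse)
    also have "inverse d ^ n = d powr (- real n)"
      using d by (simp add: powr_minus powr_realpow power_inverse)
    also have "d powr (real n + 1 - s) * d powr (- real n) = d powr (1 - s)"
      by (simp flip: powr_add)
    finally show ?case using t by (simp add: norm_mult d_def s_def)
  qed
qed

text \<open>The derivative of the logarithm is essentially the kernel, and its p-th power has the
  critical exponent \<open>c = p = \<alpha> + 2\<close>, so its integral is at most a constant times
  \<open>L(a)\<close>. The factor \<open>L(a)^(-1/p)\<close> compensates this and leaves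
  \<open>L(a)^(1-1/p)\<close> on the diagonal.\<close>

lemma order_bounded_volterra_eq:
  assumes p: "1 < p" and q: "0 < q" and g: "g holomorphic_on unit_disc"
  shows "order_bounded (p - 2) p \<beta> q (volterra g) \<longleftrightarrow>
    (\<integral>\<^sup>+z. ennreal ((cmod (deriv g z) * ln (2 / (1 - (cmod z)\<^sup>2)) powr (1 - 1 / p)) powr q) \<partial>weighted_area \<beta>) < \<infinity>"
proof -
  have p0: "0 < p" using p by simp
  define L where "L a = ln (2 / (1 - (cmod a)\<^sup>2))" for a
  have L_eq: "L a = ln 2 - ln (1 - (cmod a)\<^sup>2)" if "a \<in> unit_disc" for a
    unfolding L_def using defect_bounds[OF that] by (simp add: ln_div)
  have L_ge: "ln 2 \<le> L a" if "a \<in> unit_disc" for a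
    using L_eq[OF that] defect_bounds[OF that] by simp
  have ln2: "ln (2::real) > 0" by simp
  have L_pos: "L a > 0" if "a \<in> unit_disc" for a using L_ge[OF that] ln2 by linarith
  have L_cont: "continuous_on unit_disc L"
    unfolding L_def using defect_bounds(1)
    by (intro continuous_intros) (auto simp: less_imp_neq[symmetric])
  \<comment> \<open>The second factor is \<open>log (2 / (1 - cnj a z))\<close>, split so that the
    principal branch is only used at points of positive real part.\<close>
  define f where "f a z = of_real (L a powr (- (1 / p))) * (of_real (ln 2) - Ln (1 - cnj a * z))" for a z
  \<comment> \<open>Since \<open>L \<ge> ln 2\<close>, the constant \<open>1 / (p - 1)\<close> is at
    most \<open>1 / (p - 1) / ln 2 * L\<close>; the 1 accounts for
    \<open>- ln d \<le> L\<close>.\<close>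
  define J where "J = 1 / (p - 1) / ln 2 + 1"
  have J: "J \<ge> 0" using p ln2 by (simp add: J_def)
  \<comment> \<open>At the origin the test function has modulus \<open>L(a)^(-1/p) * ln 2\<close>,
    largest where \<open>L\<close> takes its minimum \<open>ln 2\<close>.\<close>
  define A where "A = ln 2 powr (- (1 / p)) * ln (2::real)"
  define B where "B = 3 * (p / (p - 1)) * 2 powr (p - 1) * J"
  have B: "B \<ge> 0" using p J by (simp add: B_def)
  define t where "t = inverse ((A powr p + B + 1) powr (1 / p))"
  have "A powr p + B + 1 > 0" using B powr_ge_zero[of A p] by linarith
  then have t: "t > 0" by (simp add: t_def)
  obtain C where C: "C > 0"
    "\<And>f z. \<lbrakk>f \<in> dirichlet_space (p - 2) p; dirichlet_norm (p - 2) p f \<le> 1; z \<in> unit_disc\<rbrakk> \<Longrightarrow>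
      cmod (f z) \<le> 1 + C * ln (2 / (1 - (cmod z)\<^sup>2)) powr (1 - 1 / p)"
    by (rule growth_log[OF p]) (rule that)
  have slit: "1 - cnj a * z \<notin> \<real>\<^sub>\<le>\<^sub>0" if "a \<in> unit_disc" "z \<in> unit_disc" for a z
    using one_minus_cnj_mult(1)[OF that] by (auto simp: complex_nonpos_Reals_iff)
  have hol: "f a holomorphic_on unit_disc" if "a \<in> unit_disc" for a
    unfolding f_def using slit[OF that] by (intro holomorphic_intros) auto
  have f0: "cmod (f a 0) \<le> A" if "a \<in> unit_disc" for a
    unfolding f_def A_def using L_ge[OF that] L_pos[OF that] p
    by (auto simp: norm_mult intro!: mult_right_mono powr_mono2')
  have int: "dirichlet_integral (p - 2) p (f a) \<le> ennreal B" if a: "a \<in> unit_disc" for a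
  proof -
    define d where "d = 1 - (cmod a)\<^sup>2"
    have d: "d > 0" "d \<le> 1" using defect_bounds[OF a] by (simp_all add: d_def)
    have "dirichlet_integral (p - 2) p (f a) \<le> ennreal (3 * (p / (p - 1)) * 2 powr (p - 1) * (1 / L a * (J * L a)))"
    proof (rule dirichlet_integral_le_kernel[OF p a hol[OF a]])
      have "(\<integral>\<^sup>+x. ennreal (x powr (p - 2) * max x d powr (1 - p)) * indicator {0<..1} x \<partial>lborel) \<le> ennreal (1 / (p - 1) - ln d)"
        using truncated_powr_integral_eq[of "p - 2" d] p d by simp
      also have "1 / (p - 1) - ln d \<le> J * L a"
      proof -
        have "1 / (p - 1) / ln 2 * ln 2 \<le> 1 / (p - 1) / ln 2 * L a"
          using L_ge[OF a] p ln2 by (intro mult_left_mono) auto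
        moreover have "- ln d \<le> L a" using L_eq[OF a] ln2 by (simp add: d_def)
        ultimately show ?thesis by (simp add: J_def distrib_right)
      qed
      finally show "(\<integral>\<^sup>+x. ennreal (x powr (p - 2) * max x (1 - (cmod a)\<^sup>2) powr (1 - p)) * indicator {0<..1} x \<partial>lborel) \<le> ennreal (J * L a)"
        by (simp add: d_def ennreal_leI)
      fix w assume w: "w \<in> unit_disc"
      let ?v = "1 - cnj a * w"
      have v: "?v \<noteq> 0" by (rule one_minus_cnj_mult(2)[OF a w])
      have "(f a has_field_derivative of_real (L a powr (- (1 / p))) * (cnj a / ?v)) (at w)"
        unfolding f_def using slit[OF a w] v
        by (auto intro!: derivative_eq_intros simp: field_simps)
      then have "deriv (f a) w = of_real (L a powr (- (1 / p))) * (cnj a / ?v)"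
        by (rule DERIV_imp_deriv)
      then have "cmod (deriv (f a) w) = L a powr (- (1 / p)) * (cmod a * (1 / cmod ?v))"
        by (simp add: norm_mult norm_divide)
      also have "\<dots> \<le> L a powr (- (1 / p)) * (1 * (1 / cmod ?v))"
        using a by (intro mult_left_mono mult_right_mono) auto
      finally have "cmod (deriv (f a) w) powr p \<le> (L a powr (- (1 / p)) * (1 * (1 / cmod ?v))) powr p"
        using p by (intro powr_mono2) auto
      also have "\<dots> = 1 / L a * cmod ?v powr (- p)"
        using p L_pos[OF a] by (simp add: powr_mult powr_powr powr_divide powr_minus field_simps)
      finally show "cmod (deriv (f a) w) powr p \<le> 1 / L a * cmod ?v powr (- p)" .
    qed (use J L_pos[OF a] in auto)
    also have "1 / L a * (J * L a) = J" using L_pos[OF a] by simp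
    finally show ?thesis by (simp add: B_def)
  qed
  show ?thesis
    unfolding L_def[symmetric]
  proof (rule order_bounded_volterra_iff[OF p0 q g, where k = "\<lambda>a z. of_real t * f a z" and c = t
        and C = "inverse (ln 2 powr (1 - 1 / p)) + C"], goal_cases)
    case 1
    show ?case using L_pos by (intro continuous_intros continuous_on_powr' L_cont) (auto simp: less_imp_neq[symmetric])
  next
    case (2 z)
    show ?case using L_pos[OF 2] by simp
  next
    case (3 f z)
    have "ln 2 powr (1 - 1 / p) \<le> L z powr (1 - 1 / p)"
      using L_ge[OF 3(3)] p ln2 by (intro powr_mono2) auto
    then have "1 \<le> inverse (ln 2 powr (1 - 1 / p)) * L z powr (1 - 1 / p)"
      using ln2 by (simp add: field_simps)
    then show ?case using C(2)[OF 3] by (simp add: L_def distrib_right)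
  next
    case (4 a)
    show ?case using normalized_in_dirichlet_space(1)[OF p0 hol[OF 4] f0[OF 4] int[OF 4] B] by (simp add: t_def)
  next
    case (5 a)
    show ?case using normalized_in_dirichlet_space(2)[OF p0 hol[OF 5] f0[OF 5] int[OF 5] B] by (simp add: t_def)
  next
    case (6 z)
    show ?case
      unfolding f_def using slit[OF _ 6] L_pos
      by (intro continuous_intros continuous_on_powr' L_cont) (auto simp: less_imp_neq[symmetric])
  next
    case 7
    show ?case by (rule t)
  next
    case (8 a)
    have "Ln (1 - cnj a * a) = of_real (ln (1 - (cmod a)\<^sup>2))"
      unfolding one_minus_cnj_self using defect_bounds(1)[OF 8] by (rule Ln_of_real)
    then have "f a a = of_real (L a powr (- (1 / p)) * L a)"
      by (simp add: f_def L_eq[OF 8])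
    moreover have "L a powr (- (1 / p)) * L a = L a powr (1 - 1 / p)"
      using L_pos[OF 8] by (simp add: powr_diff powr_minus field_simps)
    ultimately show ?case using t by (simp add: norm_mult)
  qed
qed

text \<open>For \<open>s < 1\<close> the growth bound is a constant, and the constant function 1
  attains it up to a factor. So \<open>\<Phi> = 1\<close> works, and the criterion becomes
  finiteness of the Dirichlet integral of \<open>g\<close>.\<close>

lemma order_bounded_volterra_greater:
  assumes p: "0 < p" and q: "0 < q" and g: "g holomorphic_on unit_disc" and gt: "p > \<alpha> + 2"
  shows "order_bounded \<alpha> p \<beta> q (volterra g) \<longleftrightarrow> g \<in> dirichlet_space \<beta> q"
proof -
  define s where "s = (\<alpha> + 2) / p"
  have s: "s < 1" using gt p by (simp add: s_def)
  obtain C where C: "C > 0"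
    "\<And>f z. \<lbrakk>f \<in> dirichlet_space \<alpha> p; dirichlet_norm \<alpha> p f \<le> 1; z \<in> unit_disc\<rbrakk> \<Longrightarrow>
      cmod (f z) \<le> 1 + C * (((1 - cmod z) powr (1 - (\<alpha> + 2) / p) - 1) / ((\<alpha> + 2) / p - 1))"
    by (rule growth_powr[OF p, of \<alpha>]) (use gt in \<open>auto intro: that\<close>)
  have "dirichlet_integral \<alpha> p (\<lambda>_. 1) = 0" using p by (simp add: dirichlet_integral_def)
  then have one: "(\<lambda>_. 1) \<in> dirichlet_space \<alpha> p" "dirichlet_norm \<alpha> p (\<lambda>_. 1) \<le> 1"
    by (simp_all add: dirichlet_space_def dirichlet_norm_def)
  have "order_bounded \<alpha> p \<beta> q (volterra g) \<longleftrightarrow>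
    (\<integral>\<^sup>+z. ennreal ((cmod (deriv g z) * 1) powr q) \<partial>weighted_area \<beta>) < \<infinity>"
  proof (rule order_bounded_volterra_iff[OF p q g, where k = "\<lambda>_ _. 1" and c = 1 and C = "1 + C / (1 - s)"], goal_cases)
    case (3 f z)
    have "((1 - cmod z) powr (1 - s) - 1) / (s - 1) = (1 - (1 - cmod z) powr (1 - s)) / (1 - s)"
      using s by (simp add: field_simps)
    also have "\<dots> \<le> 1 / (1 - s)"
      using s by (intro divide_right_mono) auto
    finally have "C * (((1 - cmod z) powr (1 - s) - 1) / (s - 1)) \<le> C * (1 / (1 - s))"
      using C(1) by (intro mult_left_mono) auto
    then show ?case using C(2)[OF 3] by (simp add: s_def)
  qed (use one in auto)
  then show ?thesis using g by (simp add: dirichlet_space_def dirichlet_integral_def)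
qed

theorem theorem9:
  fixes \<alpha> \<beta> p q :: real and g :: "complex \<Rightarrow> complex"
  assumes "\<alpha> > -1" and "\<beta> > -1"
    and "g holomorphic_on unit_disc"
    and "0 < p" and "0 < q"
  shows
    "(p < \<alpha> + 2 \<longrightarrow>
        (order_bounded \<alpha> p \<beta> q (volterra g) \<longleftrightarrow>
         (\<integral>\<^sup>+ z. ennreal (cmod (deriv g z) powr q
                   / (1 - (cmod z)\<^sup>2) powr (q * (\<alpha> + 2 - p) / p)) \<partial>weighted_area \<beta>) < \<infinity>)) \<and>
     (p = \<alpha> + 2 \<longrightarrow>
        (order_bounded \<alpha> p \<beta> q (volterra g) \<longleftrightarrow>
         (\<integral>\<^sup>+ z. ennreal (cmod (deriv g z) powr q
                   / (ln (2 / (1 - (cmod z)\<^sup>2))) powr (q * (1 - p) / p)) \<partial>weighted_area \<beta>) < \<infinity>)) \<and>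
     (p > \<alpha> + 2 \<longrightarrow>
        (order_bounded \<alpha> p \<beta> q (volterra g) \<longleftrightarrow> g \<in> dirichlet_space \<beta> q))"
proof (intro conjI impI)
  \<comment> \<open>Brings \<open>(|g'| \<Phi>)^q\<close> into the quotient form of the
    statement.\<close>
  have quot: "(x * y powr (- r)) powr q = x powr q / y powr (q * r)" for x y r :: real
    by (simp add: powr_mult powr_powr powr_minus_divide powr_divide mult.commute)
  show "order_bounded \<alpha> p \<beta> q (volterra g) \<longleftrightarrow>
         (\<integral>\<^sup>+ z. ennreal (cmod (deriv g z) powr q
                   / (1 - (cmod z)\<^sup>2) powr (q * (\<alpha> + 2 - p) / p)) \<partial>weighted_area \<beta>) < \<infinity>"
    if "p < \<alpha> + 2"
  proof -
    have "1 - (\<alpha> + 2) / p = - ((\<alpha> + 2 - p) / p)" using assms(4) by (simp add: field_simps)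
    with order_bounded_volterra_less[OF assms(1,4,5,3) that, of \<beta>] show ?thesis
      by (simp add: quot)
  qed
  show "order_bounded \<alpha> p \<beta> q (volterra g) \<longleftrightarrow>
         (\<integral>\<^sup>+ z. ennreal (cmod (deriv g z) powr q
                   / (ln (2 / (1 - (cmod z)\<^sup>2))) powr (q * (1 - p) / p)) \<partial>weighted_area \<beta>) < \<infinity>"
    if "p = \<alpha> + 2"
  proof -
    have "1 - 1 / p = - ((1 - p) / p)" using assms(4) by (simp add: field_simps)
    \<comment> \<open>Here \<open>\<alpha> = p - 2\<close>, and \<open>\<alpha> > -1\<close> yields
      \<open>p > 1\<close>.\<close>
    with order_bounded_volterra_eq[of p q g \<beta>] assms that show ?thesis
      by (simp add: quot)
  qed
  show "order_bounded \<alpha> p \<beta> q (volterra g) \<longleftrightarrow> g \<in> dirichlet_space \<beta> q" if "p > \<alpha> + 2"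
    using that assms by (intro order_bounded_volterra_greater) auto
qed

end
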